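(* Let $T$ be maximal monotone and let a stochastic first-order oracle for $T$ with state-dependent moment bounds be available (as described in the context). Let $\lambda>0$ and $N_k=\lceil (k+1)^{2a}\rceil$ for all $k$, where $a>1$. Let $\{\mathbf{x}^k\}$ be a sequence generated by the scheme (VR-SPP) described in the context, and let $T_\lambda=\tfrac1\lambda(I-(I+\lambda T)^{-1})$ be the Yosida approximation of $T$. Then: (a) For any $k\ge0$, $\mathbb{E}[\|T_\lambda(\mathbf{x}^k)\|^2]=\mathcal{O}\!\left(\tfrac{1}{k+1}\right)$, i.e. there is a constant $\widehat C$ with $\mathbb{E}[\|T_\lambda(\mathbf{x}^k)\|^2]\le\widehat C/(k+1)$ for all $k\ge 0$. (b) The oracle complexity of computing an iterate $\mathbf{x}^{K+1}$ satisfying $\mathbb{E}[\|T_\lambda(\mathbf{x}^{K+1})\|^2]\le\epsilon$ (i.e. the total number $\sum_{k=0}^{K}N_k$ of oracle calls needed) satisfies $\sum_{k=0}^{K}N_k=\mathcal{O}\!\left(\tfrac{1}{\epsilon^{2a+1}}\right)$ as $\epsilon\downarrow0$.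
   Context: Game. There are $\mathbf{N}$ players; player $i$ has a closed convex strategy set $\mathcal{X}_i\subseteq\mathbb{R}^{n_i}$, $\sum_i n_i=n$, $\mathcal{X}=\prod_i\mathcal{X}_i$. Given $\mathbf{x}^{-i}=(\mathbf{x}^j)_{j\ne i}$, player $i$ minimizes over $\mathbf{x}^i\in\mathcal{X}_i$ the function $\mathbb{E}[\tilde f_i(\mathbf{x}^i,\mathbf{x}^{-i},\mathbf{y}^i(\mathbf{x},\omega),\omega)]$, where $\mathbf{y}^i(\mathbf{x},\omega)$ is the unique solution of the lower-level variational inequality $\mathrm{VI}(\mathcal{Y}_i,F_i(\cdot,\mathbf{x},\omega))$ with $\mathcal{Y}_i$ closed convex and $F_i(\cdot,\mathbf{x},\omega)$ strongly monotone for every $\mathbf{x}\in\mathcal{X}$ and $\omega$; for each $\omega$ and each $\mathbf{x}^{-i}$, the implicit function $\mathbf{x}^i\mapsto\tilde f_i(\mathbf{x}^i,\mathbf{x}^{-i},\mathbf{y}^i(\mathbf{x},\omega),\omega)$ is convex on $\mathcal{X}_i$. Set $\Phi(\mathbf{x},\mathbf{y}(\mathbf{x},\omega),\omega)=\prod_{i=1}^{\mathbf{N}}[\partial_{\mathbf{x}^i}\tilde f_i(\mathbf{x}^i,\mathbf{x}^{-i},\mathbf{y}^i(\mathbf{x},\omega),\omega)+\mathcal{N}_{\mathcal{X}_i}(\mathbf{x}^i)]$ (normal cone $\mathcal{N}$; subdifferential of the implicit function in $\mathbf{x}^i$) and $T(\mathbf{x})=\mathbb{E}[\Phi(\mathbf{x},\mathbf{y}(\mathbf{x},\omega),\omega)]$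 (Aumann expectation). $T:\mathbb{R}^n\rightrightarrows\mathbb{R}^n$ is assumed monotone, and the game is assumed to have a Nash equilibrium, so $T^{-1}(0)\neq\emptyset$. Oracle. There are constants $M_1,M_2$ such that, given any $\mathbf{x}$, the oracle returns $v(\mathbf{x},\omega)\in\Phi(\mathbf{x},\mathbf{y}(\mathbf{x},\omega),\omega)$ with $\mathbb{E}[v(\mathbf{x},\omega)\mid\mathbf{x}]=v(\mathbf{x})\in T(\mathbf{x})$ and $\mathbb{E}[\|v(\mathbf{x},\omega)\|^2\mid\mathbf{x}]\le M_1^2\|\mathbf{x}\|^2+M_2^2$ a.s. Scheme (VR-SPP). Given (deterministic) $\mathbf{x}^0$, $\lambda>0$, sample sizes $N_k$ and $\theta>\lambda$: at outer iteration $k\ge0$ set $\mathbf{z}^k_0=\mathbf{x}^k$ and, for $j=0,\dots,N_k-1$, $\mathbf{z}^k_{j+1}=\mathbf{z}^k_j-\alpha_j u^k_j$ with $u^k_j=v^k_j+\tfrac1\lambda(\mathbf{z}^k_j-\mathbf{x}^k)$, where $v^k_j=v(\mathbf{z}^k_j,\omega_{k,j})$ is an oracle output at $\mathbf{z}^k_j$ with fresh independent sample $\omega_{k,j}$ (so the oracle properties hold conditionally on the past), and $\alpha_j=\theta/(j+1)$. Then $\mathbf{x}^{k+1}=\mathbf{z}^k_{N_k}$; this is an approximation of the resolvent $(I+\lambda T)^{-1}(\mathbf{x}^k)$. Iteration $k$ uses $N_k$ oracle calls. *)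

theory Defs
  imports "HOL-Probability.Probability" "HOL-Library.Landau_Symbols"
begin

definition monotone_op :: "('a::real_inner \<Rightarrow> 'a set) \<Rightarrow> bool" where
  "monotone_op T \<longleftrightarrow> (\<forall>x y. \<forall>u\<in>T x. \<forall>v\<in>T y. 0 \<le> (u - v) \<bullet> (x - y))"

definition maximal_monotone :: "('a::real_inner \<Rightarrow> 'a set) \<Rightarrow> bool" where
  "maximal_monotone T \<longleftrightarrow>
     monotone_op T \<and> (\<forall>S. monotone_op S \<and> (\<forall>x. T x \<subseteq> S x) \<longrightarrow> S = T)"

(* (I + lam T)^{-1}; well defined and single-valued when T is maximal monotone and lam > 0. *)
definition resolvent :: "real \<Rightarrow> ('a::real_inner \<Rightarrow> 'a set) \<Rightarrow> 'a \<Rightarrow> 'a" where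
  "resolvent lam T x = (THE z. \<exists>u\<in>T z. x = z + lam *\<^sub>R u)"

definition yosida :: "real \<Rightarrow> ('a::real_inner \<Rightarrow> 'a set) \<Rightarrow> 'a \<Rightarrow> 'a" where
  "yosida lam T x = (1 / lam) *\<^sub>R (x - resolvent lam T x)"

definition aumann_expectation :: "'w measure \<Rightarrow> ('w \<Rightarrow> 'a::euclidean_space set) \<Rightarrow> 'a set" where
  "aumann_expectation M \<Gamma> =
     {integral\<^sup>L M g | g. integrable M g \<and> (AE \<omega> in M. g \<omega> \<in> \<Gamma> \<omega>)}"

(* In the next two definitions V is the linear subspace playing the role of the ambient space. *)

definition normal_cone :: "'a::real_inner set \<Rightarrow> 'a set \<Rightarrow> 'a \<Rightarrow> 'a set" where
  "normal_cone V S x = (if x \<in> S then {g\<in>V. \<forall>\<xi>\<in>S. g \<bullet> (\<xi> - x) \<le> 0} else {})"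

(* The subdifferential at x of a convex function with effective domain S. *)
definition subdifferential :: "'a::real_inner set \<Rightarrow> 'a set \<Rightarrow> ('a \<Rightarrow> real) \<Rightarrow> 'a \<Rightarrow> 'a set" where
  "subdifferential V S h x = (if x \<in> S then {g\<in>V. \<forall>\<xi>\<in>S. h \<xi> \<ge> h x + g \<bullet> (\<xi> - x)} else {})"

definition strongly_monotone_on :: "'a::real_inner set \<Rightarrow> ('a \<Rightarrow> 'a) \<Rightarrow> bool" where
  "strongly_monotone_on S F \<longleftrightarrow>
     (\<exists>\<sigma>>0. \<forall>y\<in>S. \<forall>y'\<in>S. \<sigma> * (norm (y - y'))\<^sup>2 \<le> (F y - F y') \<bullet> (y - y'))"

definition VI_solutions :: "'a::real_inner set \<Rightarrow> ('a \<Rightarrow> 'a) \<Rightarrow> 'a set" where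
  "VI_solutions S F = {y\<in>S. \<forall>y'\<in>S. 0 \<le> F y \<bullet> (y' - y)}"


(* The joint strategy space R^n = R^{n_1} x ... x R^{n_N} is real^'n, where "own c" is the player
   owning coordinate c.  Player i's space R^{n_i} is represented by the coordinate subspace
   block own i, so n_i is the number of coordinates c with own c = i. *)

definition block :: "('n \<Rightarrow> 'i) \<Rightarrow> 'i \<Rightarrow> (real ^ 'n) set" where
  "block own i = {x. \<forall>c. own c \<noteq> i \<longrightarrow> x $ c = 0}"

definition part :: "('n \<Rightarrow> 'i) \<Rightarrow> 'i \<Rightarrow> real ^ 'n \<Rightarrow> real ^ 'n" where
  "part own i x = (\<chi> c. if own c = i then x $ c else 0)"

(* The profile (\<xi>, x^{-i}). *)
definition deviate :: "('n \<Rightarrow> 'i) \<Rightarrow> 'i \<Rightarrow> real ^ 'n \<Rightarrow> real ^ 'n \<Rightarrow> real ^ 'n" where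
  "deviate own i x \<xi> = (\<chi> c. if own c = i then \<xi> $ c else x $ c)"


(* Player-specific lower-level dimensions are covered by one ambient space 'y: the lower-level
   sets may lie in (different) proper subspaces of it. *)

record ('n, 'i, 'y, 'w) hgame =
  own :: "'n \<Rightarrow> 'i"
  strat :: "'i \<Rightarrow> (real ^ 'n) set"
  low_set :: "'i \<Rightarrow> 'y set"
  low_map :: "'i \<Rightarrow> 'y \<Rightarrow> real ^ 'n \<Rightarrow> 'w \<Rightarrow> 'y"
  cost :: "'i \<Rightarrow> real ^ 'n \<Rightarrow> 'y \<Rightarrow> 'w \<Rightarrow> real"
  smp :: "'w measure"

definition profiles :: "('n::finite, 'i, 'y, 'w) hgame \<Rightarrow> (real ^ 'n) set" where
  "profiles G = {x. \<forall>i. part (own G) i x \<in> strat G i}"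

definition low_sol ::
    "('n::finite, 'i, 'y::euclidean_space, 'w) hgame \<Rightarrow> 'i \<Rightarrow> real ^ 'n \<Rightarrow> 'w \<Rightarrow> 'y" where
  "low_sol G i x \<omega> = (THE y. y \<in> VI_solutions (low_set G i) (\<lambda>y. low_map G i y x \<omega>))"

definition implicit_cost ::
    "('n::finite, 'i, 'y::euclidean_space, 'w) hgame \<Rightarrow> 'i \<Rightarrow> real ^ 'n \<Rightarrow> 'w \<Rightarrow> real" where
  "implicit_cost G i x \<omega> = cost G i x (low_sol G i x \<omega>) \<omega>"

definition hierarchical_game ::
    "('n::finite, 'i, 'y::euclidean_space, 'w) hgame \<Rightarrow> bool" where
  "hierarchical_game G \<longleftrightarrow>
     prob_space (smp G) \<and>
     (\<forall>i. strat G i \<subseteq> block (own G) i \<and> closed (strat G i) \<and> convex (strat G i)) \<and>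
     (\<forall>i. closed (low_set G i) \<and> convex (low_set G i)) \<and>
     (\<forall>i. \<forall>x\<in>profiles G. \<forall>\<omega>\<in>space (smp G).
        strongly_monotone_on (low_set G i) (\<lambda>y. low_map G i y x \<omega>) \<and>
        (\<exists>!y. y \<in> VI_solutions (low_set G i) (\<lambda>y. low_map G i y x \<omega>))) \<and>
     (\<forall>i. \<forall>x\<in>profiles G. \<forall>\<omega>\<in>space (smp G).
        convex_on (strat G i) (\<lambda>\<xi>. implicit_cost G i (deviate (own G) i x \<xi>) \<omega>)) \<and>
     (\<forall>i. \<forall>x\<in>profiles G. integrable (smp G) (implicit_cost G i x))"

definition nash_equilibrium ::
    "('n::finite, 'i, 'y::euclidean_space, 'w) hgame \<Rightarrow> real ^ 'n \<Rightarrow> bool" where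
  "nash_equilibrium G x \<longleftrightarrow>
     x \<in> profiles G \<and>
     (\<forall>i. \<forall>\<xi>\<in>strat G i.
        (LINT \<omega>|smp G. implicit_cost G i x \<omega>)
          \<le> (LINT \<omega>|smp G. implicit_cost G i (deviate (own G) i x \<xi>) \<omega>))"

definition Phi ::
    "('n::finite, 'i, 'y::euclidean_space, 'w) hgame \<Rightarrow> real ^ 'n \<Rightarrow> 'w \<Rightarrow> (real ^ 'n) set" where
  "Phi G x \<omega> =
     {g. \<forall>i. part (own G) i g \<in>
          {d + u | d u.
             d \<in> subdifferential (block (own G) i) (strat G i)
                  (\<lambda>\<xi>. implicit_cost G i (deviate (own G) i x \<xi>) \<omega>) (part (own G) i x) \<and>
             u \<in> normal_cone (block (own G) i) (strat G i) (part (own G) i x)}}"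

definition game_op ::
    "('n::finite, 'i, 'y::euclidean_space, 'w) hgame \<Rightarrow> real ^ 'n \<Rightarrow> (real ^ 'n) set" where
  "game_op G x = aumann_expectation (smp G) (Phi G x)"


(* Phi is empty outside the strategy space, so the oracle can only be queried at x in profiles G;
   the values of v elsewhere are irrelevant. *)
definition first_order_oracle ::
    "('n::finite, 'i, 'y::euclidean_space, 'w) hgame \<Rightarrow> (real ^ 'n \<Rightarrow> 'w \<Rightarrow> real ^ 'n)
      \<Rightarrow> real \<Rightarrow> real \<Rightarrow> bool" where
  "first_order_oracle G v M1 M2 \<longleftrightarrow>
     (\<lambda>(x, \<omega>). v x \<omega>) \<in> borel_measurable (borel \<Otimes>\<^sub>M smp G) \<and>
     (\<forall>x\<in>profiles G.
        (AE \<omega> in smp G. v x \<omega> \<in> Phi G x \<omega>) \<and>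
        integrable (smp G) (v x) \<and>
        (LINT \<omega>|smp G. v x \<omega>) \<in> game_op G x \<and>
        integrable (smp G) (\<lambda>\<omega>. (norm (v x \<omega>))\<^sup>2) \<and>
        (LINT \<omega>|smp G. (norm (v x \<omega>))\<^sup>2) \<le> M1\<^sup>2 * (norm x)\<^sup>2 + M2\<^sup>2)"

(* The sample used in inner step j < N k of outer iteration k is \<omega> k j. *)
definition fresh_samples ::
    "'s measure \<Rightarrow> 'w measure \<Rightarrow> (nat \<Rightarrow> nat) \<Rightarrow> (nat \<Rightarrow> nat \<Rightarrow> 's \<Rightarrow> 'w) \<Rightarrow> bool" where
  "fresh_samples P M N \<omega> \<longleftrightarrow>
     prob_space.indep_vars P (\<lambda>_. M) (\<lambda>(k, j). \<omega> k j) {(k, j). j < N k} \<and>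
     (\<forall>k. \<forall>j<N k. distr P M (\<omega> k j) = M)"

(* The last clause says that v (z k j) (\<omega> k j) is a legitimate oracle output.  It holds
   automatically if every point can be queried, which forces profiles G = UNIV. *)
definition vr_spp ::
    "('n::finite, 'i, 'y::euclidean_space, 'w) hgame \<Rightarrow> (real ^ 'n \<Rightarrow> 'w \<Rightarrow> real ^ 'n)
      \<Rightarrow> 's measure \<Rightarrow> (nat \<Rightarrow> nat \<Rightarrow> 's \<Rightarrow> 'w) \<Rightarrow> real \<Rightarrow> real \<Rightarrow> (nat \<Rightarrow> nat) \<Rightarrow> real ^ 'n
      \<Rightarrow> (nat \<Rightarrow> 's \<Rightarrow> real ^ 'n) \<Rightarrow> (nat \<Rightarrow> nat \<Rightarrow> 's \<Rightarrow> real ^ 'n) \<Rightarrow> bool" where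
  "vr_spp G v P \<omega> lam \<theta> N x0 x z \<longleftrightarrow>
     (\<forall>s\<in>space P.
        x 0 s = x0 \<and>
        (\<forall>k. z k 0 s = x k s \<and>
             (\<forall>j<N k. z k (Suc j) s =
                z k j s - (\<theta> / real (j + 1)) *\<^sub>R
                  (v (z k j s) (\<omega> k j s) + (1 / lam) *\<^sub>R (z k j s - x k s))) \<and>
             x (Suc k) s = z k (N k) s)) \<and>
     (\<forall>k. \<forall>j<N k. AE s in P. z k j s \<in> profiles G)"

end

theory Submission
  imports Defs
begin

text \<open>Write \<open>J\<close> for the resolvent and \<open>Y\<close> for the Yosida approximation. For fixed \<open>x\<close> the inner loop is
  stochastic approximation for a strongly monotone inclusion solved by \<open>J x\<close>; since \<open>\<theta> > lam\<close>, its mean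
  square error after \<open>N\<close> steps is \<open>O(1 / N)\<close>. Hence the outer iterates satisfy
  \<open>x\<^bsub>k+1\<^esub> = J x\<^sub>k + e\<^sub>k\<close> with \<open>\<parallel>e\<^sub>k\<parallel> = O((k + 1)\<^bsup>-a\<^esup>)\<close> in \<open>L\<^sup>2\<close>, and they are bounded because \<open>a > 1\<close>.

  Perturbing the monotone decay of \<open>\<parallel>Y x\<^sub>k\<parallel>\<close> step by step gives the rate \<open>O(1 / sqrt k)\<close> only for
  \<open>a \<ge> 3/2\<close>. Instead the perturbed trajectory is compared with exact trajectories restarted from it.
  Firm nonexpansiveness gives \<open>lam\<^sup>2 * (\<Sum>l. \<parallel>Y J\<^sup>l u - Y J\<^sup>l w\<parallel>\<^sup>2) \<le> \<parallel>u - w\<parallel>\<^sup>2\<close>, so two exact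
  trajectories with initial gap \<open>\<delta>\<close> have values of \<open>Y\<close> within \<open>\<delta> / (lam * sqrt m)\<close> of each other at
  some time among the first \<open>m\<close>; and \<open>\<parallel>Y J\<^sup>l u\<parallel>\<close> is nonincreasing in \<open>l\<close>. Restarting at the dyadic times
  \<open>k + 1 - 2\<^sup>i\<close>, where the gap is \<open>O(2\<^sup>i / k)\<close> and the window has length of order \<open>2\<^sup>i\<close>, the losses
  form a geometric series with sum \<open>O(1 / sqrt k)\<close>.\<close>

section \<open>Resolvents of maximal monotone operators\<close>

text \<open>Twice a weighted variance is the weighted sum of squared pairwise distances, which a
  contraction can only shrink; measuring the spread about a point other than the mean only increases
  it.\<close>

lemma weighted_variance_le:
  fixes p q :: "'b \<Rightarrow> 'a::real_inner" and u :: "'b \<Rightarrow> real"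
  assumes u: "\<And>i. i \<in> I \<Longrightarrow> 0 \<le> u i" "sum u I = 1"
    and contr: "\<And>i j. i \<in> I \<Longrightarrow> j \<in> I \<Longrightarrow> norm (q i - q j) \<le> norm (p i - p j)"
  shows "(\<Sum>i\<in>I. u i * (norm (q i - (\<Sum>j\<in>I. u j *\<^sub>R q j)))\<^sup>2) \<le> (\<Sum>i\<in>I. u i * (norm (p i - x))\<^sup>2)"
proof -
  \<comment> \<open>The centre \<open>y\<close> is free: with the mean of \<open>q\<close> the last
    term vanishes, with \<open>x\<close> it has the favourable sign.\<close>
  have pairs: "(\<Sum>i\<in>I. \<Sum>j\<in>I. u i * u j * (norm (f i - f j))\<^sup>2)
      = 2 * (\<Sum>i\<in>I. u i * (norm (f i - y))\<^sup>2) - 2 * (norm ((\<Sum>j\<in>I. u j *\<^sub>R f j) - y))\<^sup>2"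
    for f :: "'b \<Rightarrow> 'a" and y
  proof -
    define g where "g i = f i - y" for i
    have g: "(\<Sum>j\<in>I. u j *\<^sub>R f j) - y = (\<Sum>j\<in>I. u j *\<^sub>R g j)"
      by (simp add: g_def scaleR_diff_right sum_subtractf scaleR_sum_left[symmetric] u(2))
    have "(\<Sum>i\<in>I. \<Sum>j\<in>I. u i * u j * (norm (f i - f j))\<^sup>2)
      = (\<Sum>i\<in>I. \<Sum>j\<in>I. u j * (u i * (norm (g i))\<^sup>2) + u i * (u j * (norm (g j))\<^sup>2)
            - 2 * ((u i *\<^sub>R g i) \<bullet> (u j *\<^sub>R g j)))"
      by (intro sum.cong refl)
         (simp add: g_def power2_norm_eq_inner algebra_simps inner_commute)
    also have "\<dots> = 2 * (\<Sum>i\<in>I. u i * (norm (g i))\<^sup>2)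
          - 2 * ((\<Sum>i\<in>I. u i *\<^sub>R g i) \<bullet> (\<Sum>j\<in>I. u j *\<^sub>R g j))"
      by (simp add: sum_subtractf sum.distrib sum_distrib_left[symmetric] sum_distrib_right[symmetric]
          u(2) inner_sum_left inner_sum_right del: inner_scaleR_left inner_scaleR_right)
         (rule sum.swap)
    finally show ?thesis by (simp only: g power2_norm_eq_inner) (simp add: g_def)
  qed
  have "(\<Sum>i\<in>I. \<Sum>j\<in>I. u i * u j * (norm (q i - q j))\<^sup>2) \<le> (\<Sum>i\<in>I. \<Sum>j\<in>I. u i * u j * (norm (p i - p j))\<^sup>2)"
    by (intro sum_mono mult_left_mono power_mono contr) (auto simp: u)
  then show ?thesis
    unfolding pairs[of q "\<Sum>j\<in>I. u j *\<^sub>R q j"] pairs[of p x] by simp (smt (verit) zero_le_power2)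
qed

text \<open>The centre is read off a maximiser \<open>(w, t)\<close> of the concave function \<open>t - \<parallel>w\<parallel>\<^sup>2\<close> over the convex
  hull of the points \<open>(q, \<parallel>q\<parallel>\<^sup>2 - r\<^sup>2)\<close>: the first-order condition bounds every excess
  \<open>\<parallel>q - w\<parallel>\<^sup>2 - r\<^sup>2\<close> by their weighted mean, which is nonpositive.\<close>

lemma one_point_extension_finite:
  fixes C :: "('a::euclidean_space \<times> 'a) set"
  assumes fin: "finite C"
    and contr: "\<And>c d. c \<in> C \<Longrightarrow> d \<in> C \<Longrightarrow> norm (snd c - snd d) \<le> norm (fst c - fst d)"
  shows "\<exists>w. \<forall>c\<in>C. norm (w - snd c) \<le> norm (x - fst c)"
proof (cases "C = {}")
  case False
  define h where "h c = (snd c, (norm (snd c))\<^sup>2 - (norm (x - fst c))\<^sup>2)" for c :: "'a \<times> 'a"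
  define K where "K = convex hull (h ` C)"
  have "compact K" "K \<noteq> {}" "convex K"
    using fin False by (auto simp: K_def finite_imp_compact_convex_hull)
  moreover have "continuous_on K (\<lambda>k. snd k - (norm (fst k))\<^sup>2)"
    by (intro continuous_intros)
  ultimately obtain k where k: "k \<in> K" "\<And>k'. k' \<in> K \<Longrightarrow> snd k' - (norm (fst k'))\<^sup>2 \<le> snd k - (norm (fst k))\<^sup>2"
    using continuous_attains_sup[of K "\<lambda>k. snd k - (norm (fst k))\<^sup>2"] by blast
  obtain w t where wt: "k = (w, t)" by (cases k)
  \<comment> \<open>The convex weights are indexed by image points, and \<open>h\<close> may
    identify several pairs; \<open>r\<close> picks one pair for each image point.\<close>
  define r where "r = inv_into C h"
  have r: "r s \<in> C" "h (r s) = s" if "s \<in> h ` C" for s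
    using that by (auto simp: r_def inv_into_into f_inv_into_f)
  have fst_h: "snd (r s) = fst s" and snd_h: "(norm (snd (r s)))\<^sup>2 - (norm (x - fst (r s)))\<^sup>2 = snd s"
    if "s \<in> h ` C" for s using arg_cong[OF r(2)[OF that], of fst] arg_cong[OF r(2)[OF that], of snd] by (simp_all add: h_def)
  obtain u where u: "\<And>s. s \<in> h ` C \<Longrightarrow> 0 \<le> u s" "sum u (h ` C) = 1" "(\<Sum>s\<in>h ` C. u s *\<^sub>R s) = k"
    using k(1) fin unfolding K_def convex_hull_finite[OF finite_imageI[OF fin]] by blast
  have "w = (\<Sum>s\<in>h ` C. u s *\<^sub>R fst s)"
    using arg_cong[OF u(3), of fst] by (simp add: wt fst_sum)
  then have w: "w = (\<Sum>s\<in>h ` C. u s *\<^sub>R snd (r s))"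
    by (simp add: fst_h cong: sum.cong)
  have "t = (\<Sum>s\<in>h ` C. u s * snd s)"
    using arg_cong[OF u(3), of snd] by (simp add: wt snd_sum)
  then have t: "t = (\<Sum>s\<in>h ` C. u s * ((norm (snd (r s)))\<^sup>2 - (norm (x - fst (r s)))\<^sup>2))"
    by (simp add: snd_h cong: sum.cong)
  have excess: "(norm (w - snd c))\<^sup>2 - (norm (x - fst c))\<^sup>2 \<le> 0" if c: "c \<in> C" for c
  proof -
    define s where "s = (norm (snd c))\<^sup>2 - (norm (x - fst c))\<^sup>2"
    \<comment> \<open>The derivative of \<open>t - norm w ^ 2\<close> at the maximiser in the
      direction of \<open>h c\<close>.\<close>
    define D where "D = s - t - 2 * (w \<bullet> (snd c - w))"
    have step: "\<epsilon> * D \<le> \<epsilon>\<^sup>2 * (norm (snd c - w))\<^sup>2" if "0 \<le> \<epsilon>" "\<epsilon> \<le> 1" for \<epsilon>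
    proof -
      have "h c \<in> K" using c by (auto simp: K_def hull_inc)
      then have "(1 - \<epsilon>) *\<^sub>R k + \<epsilon> *\<^sub>R h c \<in> K"
        using \<open>convex K\<close> k(1) that by (auto simp: convex_alt)
      from k(2)[OF this] have "(1 - \<epsilon>) * t + \<epsilon> * s - (norm ((1 - \<epsilon>) *\<^sub>R w + \<epsilon> *\<^sub>R snd c))\<^sup>2 \<le> t - (norm w)\<^sup>2"
        by (simp add: wt h_def s_def)
      moreover have "(1 - \<epsilon>) *\<^sub>R w + \<epsilon> *\<^sub>R snd c = w + \<epsilon> *\<^sub>R (snd c - w)"
        by (simp add: algebra_simps)
      moreover have "(norm (w + \<epsilon> *\<^sub>R (snd c - w)))\<^sup>2
          = (norm w)\<^sup>2 + 2 * \<epsilon> * (w \<bullet> (snd c - w)) + \<epsilon>\<^sup>2 * (norm (snd c - w))\<^sup>2"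
        unfolding power2_norm_eq_inner
        by (simp only: inner_add_left inner_add_right inner_commute[of "\<epsilon> *\<^sub>R (snd c - w)" w])
           (simp add: power2_eq_square)
      ultimately have "(1 - \<epsilon>) * t + \<epsilon> * s - (2 * \<epsilon> * (w \<bullet> (snd c - w)) + \<epsilon>\<^sup>2 * (norm (snd c - w))\<^sup>2) \<le> t"
        by simp
      then show ?thesis
        by (simp only: D_def left_diff_distrib right_diff_distrib)
    qed
    have "D \<le> 0"
    proof (rule ccontr)
      assume D: "\<not> D \<le> 0"
      define n where "n = (norm (snd c - w))\<^sup>2"
      have n: "n \<ge> 0" by (simp add: n_def)
      \<comment> \<open>At most 1, yet small enough that the second-order term cannot compensate a
        positive \<open>D\<close>.\<close>
      define \<epsilon> where "\<epsilon> = D / (D + n + 1)"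
      have e: "0 < \<epsilon>" "\<epsilon> \<le> 1" using D n by (auto simp: \<epsilon>_def)
      have "\<epsilon> * D \<le> \<epsilon> * (\<epsilon> * n)" using step[of \<epsilon>] e by (simp add: n_def power2_eq_square)
      then have "D \<le> \<epsilon> * n" using e by simp
      then have "D * (D + n + 1) \<le> D * n" using D n by (simp add: \<epsilon>_def field_simps)
      then show False using D by (simp add: mult_le_cancel_left)
    qed
    \<comment> \<open>The weighted mean of the excesses; by \<open>weighted_variance_le\<close> it
      is nonpositive.\<close>
    moreover have "(\<Sum>s\<in>h ` C. u s * ((norm (snd (r s) - w))\<^sup>2 - (norm (fst (r s) - x))\<^sup>2)) = t - (norm w)\<^sup>2"
    proof -
      have "(\<Sum>s\<in>h ` C. u s * ((norm (snd (r s) - w))\<^sup>2 - (norm (fst (r s) - x))\<^sup>2)) =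
        (\<Sum>s\<in>h ` C. u s * ((norm (snd (r s)))\<^sup>2 - (norm (x - fst (r s)))\<^sup>2) + u s * (norm w)\<^sup>2 - 2 * (w \<bullet> (u s *\<^sub>R snd (r s))))"
        by (intro sum.cong refl)
           (simp add: power2_norm_eq_inner algebra_simps inner_commute)
      also have "\<dots> = t + (norm w)\<^sup>2 - 2 * (w \<bullet> w)"
        by (simp only: sum_subtractf sum.distrib sum_distrib_right[symmetric] sum_distrib_left[symmetric]
             inner_sum_right[symmetric] t[symmetric] w[symmetric] u(2))
      finally show ?thesis by (simp add: power2_norm_eq_inner)
    qed
    moreover have "(\<Sum>s\<in>h ` C. u s * (norm (snd (r s) - w))\<^sup>2) \<le> (\<Sum>s\<in>h ` C. u s * (norm (fst (r s) - x))\<^sup>2)"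
      unfolding w by (rule weighted_variance_le[OF u(1,2) contr[OF r(1) r(1)]])
    moreover have "(norm (w - snd c))\<^sup>2 - (norm (x - fst c))\<^sup>2 = D + (t - (norm w)\<^sup>2)"
    proof -
      have "(norm (w - snd c))\<^sup>2 = (norm w)\<^sup>2 - 2 * (w \<bullet> snd c) + (norm (snd c))\<^sup>2"
        by (simp add: power2_norm_eq_inner inner_diff_left inner_diff_right inner_commute)
      then show ?thesis
        by (simp add: D_def s_def inner_diff_right power2_norm_eq_inner)
    qed
    ultimately show ?thesis
      by (simp add: sum_subtractf right_diff_distrib)
  qed
  have "norm (w - snd c) \<le> norm (x - fst c)" if "c \<in> C" for c
    by (rule power2_le_imp_le) (use excess[OF that] in auto)
  then show ?thesis by blast
qed simp

text \<open>The one-point case of Kirszbraun's theorem. The admissible \<open>w\<close> form an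
  intersection of closed balls whose finite subfamilies meet, and compactness carries this over to
  all of \<open>C\<close>.\<close>

lemma one_point_extension:
  fixes C :: "('a::euclidean_space \<times> 'a) set"
  assumes contr: "\<And>c d. c \<in> C \<Longrightarrow> d \<in> C \<Longrightarrow> norm (snd c - snd d) \<le> norm (fst c - fst d)"
  shows "\<exists>w. \<forall>c\<in>C. norm (w - snd c) \<le> norm (x - fst c)"
proof (cases "C = {}")
  case False
  then obtain c0 where c0: "c0 \<in> C" by blast
  define B where "B c = cball (snd c) (norm (x - fst c))" for c :: "'a \<times> 'a"
  \<comment> \<open>One ball is singled out as the compact set inside which the others are
    intersected.\<close>
  have "B c0 \<inter> (\<Inter>c\<in>C. B c) \<noteq> {}"
  proof (rule compact_imp_fip_image)
    fix I assume I: "finite I" "I \<subseteq> C"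
    have "\<exists>w. \<forall>c\<in>insert c0 I. norm (w - snd c) \<le> norm (x - fst c)"
    proof (rule one_point_extension_finite)
      show "norm (snd c - snd d) \<le> norm (fst c - fst d)" if "c \<in> insert c0 I" "d \<in> insert c0 I" for c d
        using that I(2) c0 by (intro contr) auto
    qed (use I in auto)
    then obtain w where "\<forall>c\<in>insert c0 I. norm (w - snd c) \<le> norm (x - fst c)" by blast
    then have "w \<in> B c0 \<inter> (\<Inter>c\<in>I. B c)"
      by (auto simp: B_def dist_norm norm_minus_commute)
    then show "B c0 \<inter> (\<Inter>c\<in>I. B c) \<noteq> {}" by blast
  qed (auto simp: B_def)
  then obtain w where "\<And>c. c \<in> C \<Longrightarrow> w \<in> B c" by blast
  then have "norm (w - snd c) \<le> norm (x - fst c)" if "c \<in> C" for c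
    using that by (simp add: B_def dist_norm norm_minus_commute)
  then show ?thesis by blast
qed simp

text \<open>Adding the single pair \<open>(x, u)\<close> keeps the graph monotone, so by maximality
  the pair was already there.\<close>

lemma maximal_monotone_memI:
  assumes max: "maximal_monotone T" and rel: "\<And>y v. v \<in> T y \<Longrightarrow> 0 \<le> (u - v) \<bullet> (x - y)"
  shows "u \<in> T x"
proof -
  define S where "S = T(x := insert u (T x))"
  have mono: "monotone_op T" using max by (simp add: maximal_monotone_def)
  have sym: "(p - q) \<bullet> (y - z) = (q - p) \<bullet> (z - y)" for p q y z :: 'a
    by (simp add: algebra_simps)
  have "monotone_op S"
    using mono rel rel[unfolded sym[of u]] unfolding monotone_op_def S_def by auto
  moreover have "\<forall>y. T y \<subseteq> S y" by (auto simp: S_def)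
  ultimately have "S = T" using max by (auto simp: maximal_monotone_def)
  then have "S x = T x" by simp
  then show ?thesis by (auto simp: S_def)
qed

text \<open>Minty's theorem: the Cayley transform \<open>y + lam v \<mapsto> y - lam v\<close> of a monotone graph is
  nonexpansive, so it extends to the point \<open>x\<close>.\<close>

theorem minty:
  fixes T :: "'a::euclidean_space \<Rightarrow> 'a set"
  assumes max: "maximal_monotone T" and lam: "lam > 0"
  shows "\<exists>z. \<exists>u\<in>T z. x = z + lam *\<^sub>R u"
proof -
  define C where "C = {(y + lam *\<^sub>R v, y - lam *\<^sub>R v) | y v. v \<in> T y}"
  have mono: "monotone_op T" using max by (simp add: maximal_monotone_def)
  \<comment> \<open>The two squared norms differ exactly by the monotonicity product, so monotone
    pairs correspond to nonexpansive ones, and conversely.\<close>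
  have cayley: "(norm ((y - lam *\<^sub>R v) - (y' - lam *\<^sub>R v')))\<^sup>2
      = (norm ((y + lam *\<^sub>R v) - (y' + lam *\<^sub>R v')))\<^sup>2 - 4 * lam * ((v - v') \<bullet> (y - y'))" for y v y' v' :: 'a
    by (simp add: power2_norm_eq_inner algebra_simps inner_commute)
  have "\<exists>w. \<forall>c\<in>C. norm (w - snd c) \<le> norm (x - fst c)"
  proof (rule one_point_extension)
    fix c d assume "c \<in> C" "d \<in> C"
    then obtain y v y' v' where *: "c = (y + lam *\<^sub>R v, y - lam *\<^sub>R v)" "d = (y' + lam *\<^sub>R v', y' - lam *\<^sub>R v')"
      "v \<in> T y" "v' \<in> T y'" by (auto simp: C_def)
    then have "0 \<le> lam * ((v - v') \<bullet> (y - y'))"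
      using mono lam by (auto simp: monotone_op_def)
    then have "(norm (snd c - snd d))\<^sup>2 \<le> (norm (fst c - fst d))\<^sup>2"
      using cayley[of y v y' v'] unfolding *(1,2) fst_conv snd_conv by linarith
    then show "norm (snd c - snd d) \<le> norm (fst c - fst d)" by (rule power2_le_imp_le) simp
  qed
  then obtain w where w': "\<forall>c\<in>C. norm (w - snd c) \<le> norm (x - fst c)" by blast
  have w: "norm (w - (y - lam *\<^sub>R v)) \<le> norm (x - (y + lam *\<^sub>R v))" if "v \<in> T y" for y v
  proof -
    have "(y + lam *\<^sub>R v, y - lam *\<^sub>R v) \<in> C" unfolding C_def using that by blast
    from bspec[OF w' this] show ?thesis unfolding fst_conv snd_conv .
  qed
  \<comment> \<open>The inverse Cayley transform of \<open>(x, w)\<close>.\<close>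
  define z u where "z = (1/2) *\<^sub>R (x + w)" and "u = (1 / (2 * lam)) *\<^sub>R (x - w)"
  have zu: "z + lam *\<^sub>R u = x" "z - lam *\<^sub>R u = w"
    using lam scaleR_half_double[of x] scaleR_half_double[of w]
    by (simp_all add: z_def u_def scaleR_right_diff_distrib scaleR_right_distrib)
  have "u \<in> T z"
  proof (rule maximal_monotone_memI[OF max])
    fix y v assume "v \<in> T y"
    then have "(norm (w - (y - lam *\<^sub>R v)))\<^sup>2 \<le> (norm (x - (y + lam *\<^sub>R v)))\<^sup>2"
      using w by (intro power_mono) auto
    then have "0 \<le> lam * ((u - v) \<bullet> (z - y))"
      using cayley[of z u y v] unfolding zu by simp
    then show "0 \<le> (u - v) \<bullet> (z - y)" using lam by (simp add: zero_le_mult_iff)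
  qed
  then show ?thesis using zu(1) by metis
qed

text \<open>Uniqueness for the definite description: two decompositions of \<open>x\<close> satisfy
  \<open>z' - z = lam *\<^sub>R (u - u')\<close>, and monotonicity then forces
  \<open>u = u'\<close>.\<close>

lemma resolvent_eqI:
  assumes mono: "monotone_op T" and lam: "lam > 0" and u: "u \<in> T z" "x = z + lam *\<^sub>R u"
  shows "resolvent lam T x = z"
  unfolding resolvent_def
proof (rule the_equality)
  show "\<exists>u\<in>T z. x = z + lam *\<^sub>R u" using u by blast
next
  fix z' assume "\<exists>u\<in>T z'. x = z' + lam *\<^sub>R u"
  then obtain u' where u': "u' \<in> T z'" "x = z' + lam *\<^sub>R u'" by blast
  have "z' - z = lam *\<^sub>R (u - u')" using u(2) u'(2) by (simp add: algebra_simps)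
  moreover have "0 \<le> (u' - u) \<bullet> (z' - z)" using mono u u' by (auto simp: monotone_op_def)
  ultimately have "lam * ((u - u') \<bullet> (u - u')) \<le> 0"
    by (metis inner_minus_left inner_scaleR_right minus_diff_eq neg_0_le_iff_le)
  then have "u = u'" using lam by (smt (verit) inner_gt_zero_iff mult_pos_pos right_minus_eq)
  then show "z' = z" using u(2) u'(2) by simp
qed

section \<open>Calculus of the resolvent and the Yosida approximation\<close>

locale maximal_monotone_operator =
  fixes T :: "'a::euclidean_space \<Rightarrow> 'a set" and lam :: real
  assumes max: "maximal_monotone T" and lam: "lam > 0"
begin

abbreviation "J \<equiv> resolvent lam T"
abbreviation "Y \<equiv> yosida lam T"

lemma mono: "u \<in> T x \<Longrightarrow> v \<in> T y \<Longrightarrow> 0 \<le> (u - v) \<bullet> (x - y)"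
  using max by (auto simp: maximal_monotone_def monotone_op_def)

lemma yosida_decomp: "x = J x + lam *\<^sub>R Y x"
  using lam by (simp add: yosida_def)

text \<open>Minty's theorem provides some decomposition of \<open>x\<close>, and uniqueness
  identifies it with the one given by \<open>J x\<close> and \<open>Y x\<close>.\<close>

lemma yosida_mem: "Y x \<in> T (J x)"
proof -
  obtain z u where zu: "u \<in> T z" "x = z + lam *\<^sub>R u" using minty[OF max lam, of x] by blast
  have "J x = z" by (rule resolvent_eqI) (use max lam zu in \<open>auto simp: maximal_monotone_def\<close>)
  moreover have "Y x = u" using lam by (simp add: yosida_def calculation) (simp add: zu(2))
  ultimately show ?thesis using zu by simp
qed

text \<open>Expanding \<open>x - y\<close> along the two components leaves a cross term that is
  nonnegative by monotonicity. The \<open>Y\<close> term is kept because its sum along trajectories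
  yields the rate.\<close>

lemma resolvent_firm:
  "(norm (J x - J y))\<^sup>2 + lam\<^sup>2 * (norm (Y x - Y y))\<^sup>2 \<le> (norm (x - y))\<^sup>2"
proof -
  have "x - y = (J x - J y) + lam *\<^sub>R (Y x - Y y)"
    using yosida_decomp[of x] yosida_decomp[of y] by (metis add_diff_add scaleR_diff_right)
  then have "(norm (x - y))\<^sup>2 = (norm (J x - J y))\<^sup>2 + lam\<^sup>2 * (norm (Y x - Y y))\<^sup>2
      + 2 * lam * ((Y x - Y y) \<bullet> (J x - J y))"
    by (simp only: power2_norm_eq_inner)
       (simp add: inner_add_left inner_add_right inner_commute power2_eq_square)
  moreover have "0 \<le> lam * ((Y x - Y y) \<bullet> (J x - J y))"
    using mono[OF yosida_mem yosida_mem] lam by simp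
  ultimately show ?thesis by simp
qed

lemma resolvent_nonexpansive: "norm (J x - J y) \<le> norm (x - y)"
proof (rule power2_le_imp_le)
  show "(norm (J x - J y))\<^sup>2 \<le> (norm (x - y))\<^sup>2"
    using resolvent_firm[of x y] zero_le_power2[of "lam * norm (Y x - Y y)"]
    unfolding power_mult_distrib by linarith
qed simp

lemma yosida_lipschitz: "norm (Y x - Y y) \<le> norm (x - y) / lam"
proof -
  have "lam * norm (Y x - Y y) \<le> norm (x - y)"
  proof (rule power2_le_imp_le)
    show "(lam * norm (Y x - Y y))\<^sup>2 \<le> (norm (x - y))\<^sup>2"
      using resolvent_firm[of x y] by (simp add: power_mult_distrib) (smt (verit) zero_le_power2)
  qed simp
  then show ?thesis using lam by (simp add: field_simps)
qed

text \<open>Monotonicity between the graph points over \<open>J x\<close> and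
  \<open>J (J x)\<close>, whose difference is \<open>lam *\<^sub>R Y (J x)\<close>, followed by
  Cauchy-Schwarz.\<close>

lemma yosida_resolvent_le: "norm (Y (J x)) \<le> norm (Y x)"
proof -
  have "lam *\<^sub>R Y (J x) = J x - J (J x)" using yosida_decomp[of "J x"] by (simp add: algebra_simps)
  then have "0 \<le> lam * ((Y x - Y (J x)) \<bullet> Y (J x))"
    using mono[OF yosida_mem[of x] yosida_mem[of "J x"]] by (metis inner_scaleR_right)
  then have "(norm (Y (J x)))\<^sup>2 \<le> Y x \<bullet> Y (J x)"
    using lam by (simp add: zero_le_mult_iff power2_norm_eq_inner algebra_simps)
  also have "\<dots> \<le> norm (Y x) * norm (Y (J x))" by (rule norm_cauchy_schwarz)
  finally show ?thesis by (cases "Y (J x) = 0") (simp_all add: power2_eq_square)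
qed

lemma resolvent_zero: "0 \<in> T p \<Longrightarrow> J p = p"
  using max lam by (intro resolvent_eqI) (auto simp: maximal_monotone_def)

lemma yosida_zero: "0 \<in> T p \<Longrightarrow> Y p = 0"
  by (simp add: yosida_def resolvent_zero)

lemma borel_measurable_resolvent [measurable]: "J \<in> borel_measurable borel"
  by (intro borel_measurable_continuous_onI lipschitz_on_continuous_on[of 1] lipschitz_onI)
     (use resolvent_nonexpansive in \<open>auto simp: dist_norm\<close>)

lemma borel_measurable_yosida [measurable]: "Y \<in> borel_measurable borel"
  unfolding yosida_def by measurable

end

section \<open>Square-integrable random vectors\<close>

definition sq_integrable :: "'s measure \<Rightarrow> ('s \<Rightarrow> 'a::euclidean_space) \<Rightarrow> bool" where
  "sq_integrable M f \<longleftrightarrow> f \<in> borel_measurable M \<and> integrable M (\<lambda>s. (norm (f s))\<^sup>2)"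

text \<open>For functions that are not square integrable the integral takes the default value 0, so
  estimates are paired with \<open>sq_integrable\<close>.\<close>

definition l2norm :: "'s measure \<Rightarrow> ('s \<Rightarrow> 'a::euclidean_space) \<Rightarrow> real" where
  "l2norm M f = sqrt (LINT s|M. (norm (f s))\<^sup>2)"

lemma l2norm_nonneg [simp]: "0 \<le> l2norm M f"
  by (simp add: l2norm_def)

lemma l2norm_power2: "(l2norm M f)\<^sup>2 = (LINT s|M. (norm (f s))\<^sup>2)"
  by (simp add: l2norm_def)

lemma sq_integrable_measurable: "sq_integrable M f \<Longrightarrow> f \<in> borel_measurable M"
  by (simp add: sq_integrable_def)

lemma sq_integrable_integrable: "sq_integrable M f \<Longrightarrow> integrable M (\<lambda>s. (norm (f s))\<^sup>2)"
  by (simp add: sq_integrable_def)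

text \<open>Young's inequality with free weights: equal weights give the factor 2, and weights close
  to the two norms give Minkowski's inequality after integration.\<close>

lemma norm_add_power2_le:
  fixes x y :: "'a::real_normed_vector"
  assumes "a > 0" "b > 0"
  shows "(norm (x + y))\<^sup>2 \<le> (1 + b / a) * (norm x)\<^sup>2 + (1 + a / b) * (norm y)\<^sup>2"
proof -
  have "(norm (x + y))\<^sup>2 \<le> (norm x + norm y)\<^sup>2"
    by (intro power_mono norm_triangle_ineq norm_ge_zero)
  also have "\<dots> = (norm x)\<^sup>2 + (norm y)\<^sup>2 + 2 * norm x * norm y"
    by (simp add: power2_sum)
  also have "2 * norm x * norm y \<le> b / a * (norm x)\<^sup>2 + a / b * (norm y)\<^sup>2"
  proof -
    have "0 \<le> (b * norm x - a * norm y)\<^sup>2 / (a * b)" using assms by simp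
    also have "\<dots> = b / a * (norm x)\<^sup>2 + a / b * (norm y)\<^sup>2 - 2 * norm x * norm y"
      using assms by (simp add: field_simps power2_eq_square)
    finally show ?thesis by simp
  qed
  finally show ?thesis by (simp add: algebra_simps)
qed

lemma sq_integrable_add:
  assumes "sq_integrable M f" "sq_integrable M g"
  shows "sq_integrable M (\<lambda>s. f s + g s)"
  unfolding sq_integrable_def
proof
  have [measurable]: "f \<in> borel_measurable M" "g \<in> borel_measurable M"
    using assms by (auto simp: sq_integrable_def)
  show "(\<lambda>s. f s + g s) \<in> borel_measurable M" by measurable
  have "integrable M (\<lambda>s. 2 * (norm (f s))\<^sup>2 + 2 * (norm (g s))\<^sup>2)"
    using assms by (auto simp: sq_integrable_def)
  then show "integrable M (\<lambda>s. (norm (f s + g s))\<^sup>2)"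
  proof (rule Bochner_Integration.integrable_bound)
    show "AE s in M. norm ((norm (f s + g s))\<^sup>2) \<le> norm (2 * (norm (f s))\<^sup>2 + 2 * (norm (g s))\<^sup>2)"
      using norm_add_power2_le[of 1 1] by auto
  qed measurable
qed

lemma sq_integrable_bound:
  assumes "sq_integrable M g" "f \<in> borel_measurable M" "\<And>s. norm (f s) \<le> c * norm (g s)"
  shows "sq_integrable M f"
  unfolding sq_integrable_def
proof
  note [measurable] = assms(2)
  have "integrable M (\<lambda>s. c\<^sup>2 * (norm (g s))\<^sup>2)"
    using assms(1) by (auto simp: sq_integrable_def)
  then show "integrable M (\<lambda>s. (norm (f s))\<^sup>2)"
  proof (rule Bochner_Integration.integrable_bound)
    have "(norm (f s))\<^sup>2 \<le> c\<^sup>2 * (norm (g s))\<^sup>2" for s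
      using power_mono[OF assms(3) norm_ge_zero, of s 2] by (simp add: power_mult_distrib)
    then show "AE s in M. norm ((norm (f s))\<^sup>2) \<le> norm (c\<^sup>2 * (norm (g s))\<^sup>2)" by simp
  qed measurable
qed (fact assms(2))

lemma sq_integrable_diff:
  assumes "sq_integrable M f" "sq_integrable M g"
  shows "sq_integrable M (\<lambda>s. f s - g s)"
proof -
  have "sq_integrable M (\<lambda>s. - g s)"
    by (rule sq_integrable_bound[OF assms(2), of _ 1])
       (use assms(2) in \<open>auto simp: sq_integrable_def\<close>)
  from sq_integrable_add[OF assms(1) this] show ?thesis by simp
qed

lemma (in finite_measure) sq_integrable_const: "sq_integrable M (\<lambda>_. c)"
  by (simp add: sq_integrable_def)

lemma l2norm_mono:
  assumes "sq_integrable M f" "sq_integrable M g" "\<And>s. norm (f s) \<le> norm (g s)"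
  shows "l2norm M f \<le> l2norm M g"
  unfolding l2norm_def
  by (intro real_sqrt_le_mono integral_mono sq_integrable_integrable assms power_mono) auto

lemma l2norm_le_scaled:
  assumes "sq_integrable M f" "sq_integrable M g" "c \<ge> 0" "\<And>s. norm (f s) \<le> c * norm (g s)"
  shows "l2norm M f \<le> c * l2norm M g"
proof -
  have "l2norm M f \<le> l2norm M (\<lambda>s. c *\<^sub>R g s)"
    by (rule l2norm_mono[OF assms(1) sq_integrable_bound[OF assms(2), of _ "\<bar>c\<bar>"]])
       (use assms in \<open>auto simp: sq_integrable_def\<close>)
  also have "\<dots> = c * l2norm M g"
    using assms(3) by (simp add: l2norm_def power_mult_distrib real_sqrt_mult)
  finally show ?thesis .
qed

lemma l2norm_add_le:
  assumes f: "sq_integrable M f" and g: "sq_integrable M g"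
  shows "l2norm M (\<lambda>s. f s + g s) \<le> l2norm M f + l2norm M g"
proof (rule field_le_epsilon)
  fix e :: real assume e: "e > 0"
  \<comment> \<open>The extra \<open>e / 2\<close> keeps the weights positive even if a norm
    vanishes.\<close>
  define a b where "a = l2norm M f + e / 2" and "b = l2norm M g + e / 2"
  have ab: "a > 0" "b > 0" "l2norm M f \<le> a" "l2norm M g \<le> b"
    using e l2norm_nonneg[of M f] l2norm_nonneg[of M g] unfolding a_def b_def by linarith+
  have "(l2norm M (\<lambda>s. f s + g s))\<^sup>2
      \<le> (LINT s|M. (1 + b / a) * (norm (f s))\<^sup>2 + (1 + a / b) * (norm (g s))\<^sup>2)"
    unfolding l2norm_power2
    by (intro integral_mono sq_integrable_integrable sq_integrable_add f g norm_add_power2_le ab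
        Bochner_Integration.integrable_add integrable_mult_right)
  also have "\<dots> = (1 + b / a) * (l2norm M f)\<^sup>2 + (1 + a / b) * (l2norm M g)\<^sup>2"
    using f g by (simp add: sq_integrable_def l2norm_power2)
  also have "\<dots> \<le> (1 + b / a) * a\<^sup>2 + (1 + a / b) * b\<^sup>2"
    using ab by (intro add_mono mult_left_mono power_mono) auto
  also have "\<dots> = (a + b)\<^sup>2"
    using ab by (simp add: field_simps power2_eq_square)
  finally have "l2norm M (\<lambda>s. f s + g s) \<le> a + b"
    by (rule power2_le_imp_le) (use ab in simp)
  then show "l2norm M (\<lambda>s. f s + g s) \<le> l2norm M f + l2norm M g + e"
    by (simp add: a_def b_def)
qed

lemma l2norm_le_add_diff:
  assumes "sq_integrable M f" "sq_integrable M g"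
  shows "l2norm M f \<le> l2norm M g + l2norm M (\<lambda>s. f s - g s)"
  using l2norm_add_le[OF assms(2) sq_integrable_diff[OF assms]] by simp

lemma l2norm_diff_triangle:
  assumes "sq_integrable M f" "sq_integrable M g" "sq_integrable M h"
  shows "l2norm M (\<lambda>s. f s - h s) \<le> l2norm M (\<lambda>s. f s - g s) + l2norm M (\<lambda>s. g s - h s)"
  using l2norm_add_le[OF sq_integrable_diff[OF assms(1,2)] sq_integrable_diff[OF assms(2,3)]] by simp

section \<open>Recursive inequalities\<close>

text \<open>The constant is fixed before the sequence, \<open>Q\<close> and \<open>n\<close>, since
  every outer iteration supplies its own. Crude growth covers the first \<open>j0\<close> steps;
  afterwards the contraction beats the \<open>A\<close> term and reproduces a bound
  \<open>R / j\<close>.\<close>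

lemma robbins_monro_rate:
  fixes c A :: real
  assumes c: "c > 2" and A: "A \<ge> 0"
  obtains C where "C \<ge> 0"
    "\<And>(e::nat \<Rightarrow> real) Q n. \<lbrakk>0 \<le> Q; n \<ge> 1; \<And>j. j \<le> n \<Longrightarrow> 0 \<le> e j;
       \<And>j. j < n \<Longrightarrow> e (Suc j) \<le> (1 - c / real (j + 1) + A / (real (j + 1))\<^sup>2) * e j + Q / (real (j + 1))\<^sup>2\<rbrakk>
      \<Longrightarrow> e n \<le> C * (e 0 + Q) / real n"
proof -
  \<comment> \<open>Beyond this threshold the \<open>A\<close> term uses up at most the surplus
    \<open>c - 2\<close>, leaving the factor \<open>1 - 2 / (j + 1)\<close>.\<close>
  obtain j1 :: nat where j1: "A / (c - 2) \<le> real j1"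
    using real_arch_simple by blast
  define j0 where "j0 = Suc j1"
  have j0: "j0 \<ge> 1" "\<And>j. j \<ge> j0 \<Longrightarrow> A \<le> (c - 2) * real (j + 1)"
  proof -
    fix j assume "j \<ge> j0"
    then have "A / (c - 2) \<le> real (j + 1)" using j1 by (simp add: j0_def)
    then show "A \<le> (c - 2) * real (j + 1)" using c by (simp add: field_simps)
  qed (simp add: j0_def)
  \<comment> \<open>The power bounds the growth during the first \<open>j0\<close> steps, and the
    factor \<open>j0\<close> turns that bound into the form \<open>R / j\<close>.\<close>
  define C where "C = real j0 * (2 + A) ^ j0"
  have C: "C \<ge> 1"
    unfolding C_def using j0(1) A by (intro mult_ge1_I one_le_power) auto
  show thesis
  proof (rule that)
    fix e :: "nat \<Rightarrow> real" and Q n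
    assume Q: "0 \<le> Q" and n: "n \<ge> 1" and e: "\<And>j. j \<le> n \<Longrightarrow> 0 \<le> e j"
      and rec: "\<And>j. j < n \<Longrightarrow> e (Suc j) \<le> (1 - c / real (j + 1) + A / (real (j + 1))\<^sup>2) * e j + Q / (real (j + 1))\<^sup>2"
    define R where "R = C * (e 0 + Q)"
    have R: "R \<ge> Q" "R \<ge> 0"
      using mult_mono[of 1 C "Q" "e 0 + Q"] C e[of 0] Q by (auto simp: R_def)
    \<comment> \<open>Adding \<open>Q\<close> absorbs the inhomogeneous term into a purely
      multiplicative recursion.\<close>
    have growth: "e j + Q \<le> (2 + A) ^ j * (e 0 + Q)" if "j \<le> n" for j
      using that
    proof (induction j)
      case (Suc j)
      have "e (Suc j) \<le> (1 - c / real (j + 1) + A / (real (j + 1))\<^sup>2) * e j + Q / (real (j + 1))\<^sup>2"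
        using rec Suc.prems by simp
      also have "\<dots> \<le> (1 + A) * e j + Q"
      proof (rule add_mono[OF mult_right_mono])
        have j: "1 \<le> (real (j + 1))\<^sup>2" by (intro one_le_power) simp
        then have "A / (real (j + 1))\<^sup>2 \<le> A" "0 \<le> c / real (j + 1)"
          using divide_left_mono[OF j A] c by auto
        then show "1 - c / real (j + 1) + A / (real (j + 1))\<^sup>2 \<le> 1 + A" by simp
        show "Q / (real (j + 1))\<^sup>2 \<le> Q" using divide_left_mono[OF j Q] by auto
        show "0 \<le> e j" using e Suc.prems by simp
      qed
      finally have "e (Suc j) + Q \<le> (2 + A) * (e j + Q)"
        using e[of j] Suc.prems mult_nonneg_nonneg[OF A Q] by (simp add: algebra_simps)
      also have "\<dots> \<le> (2 + A) * ((2 + A) ^ j * (e 0 + Q))"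
        using Suc A by (intro mult_left_mono) auto
      finally show ?case by simp
    qed simp
    have "e j \<le> R / real j" if "1 \<le> j" "j \<le> n" for j
      using that
    proof (induction j rule: dec_induct)
      case base
      have "e 1 + Q \<le> (2 + A) ^ 1 * (e 0 + Q)" using growth[of 1] n by simp
      also have "\<dots> \<le> (2 + A) ^ j0 * (e 0 + Q)"
        using A j0(1) e[of 0] Q by (intro mult_right_mono power_increasing) auto
      also have "\<dots> \<le> R"
        using mult_right_mono[of 1 "real j0" "(2 + A) ^ j0 * (e 0 + Q)"] j0(1) A e[of 0] Q
        by (simp add: R_def C_def mult.assoc)
      finally show ?case using Q by simp
    next
      case (step j)
      show ?case
      proof (cases "Suc j \<le> j0")
        case True
        have "e (Suc j) + Q \<le> (2 + A) ^ Suc j * (e 0 + Q)" by (rule growth[OF step.prems])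
        also have "\<dots> \<le> (2 + A) ^ j0 * (e 0 + Q)"
          using A True e[of 0] Q by (intro mult_right_mono power_increasing) auto
        finally have "real (Suc j) * e (Suc j) \<le> real j0 * ((2 + A) ^ j0 * (e 0 + Q))"
          using True e[OF step.prems] Q by (intro mult_mono) auto
        then show ?thesis by (simp add: R_def C_def field_simps)
      next
        case False
        then have j: "j \<ge> j0" by simp
        have j': "real j \<ge> 1" using step.hyps by simp
        have ej: "e j \<le> R / real j" "0 \<le> e j" using step e by auto
        have "A / (real (j + 1))\<^sup>2 \<le> (c - 2) / real (j + 1)"
        proof -
          have "A / real (j + 1) \<le> c - 2" using j0(2)[OF j] by (simp add: pos_divide_le_eq)
          then have "A / real (j + 1) / real (j + 1) \<le> (c - 2) / real (j + 1)"
            by (rule divide_right_mono) simp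
          then show ?thesis by (simp add: power2_eq_square)
        qed
        then have "1 - c / real (j + 1) + A / (real (j + 1))\<^sup>2 \<le> 1 - 2 / real (j + 1)"
          by (simp add: diff_divide_distrib)
        then have "e (Suc j) \<le> (1 - 2 / real (j + 1)) * e j + Q / (real (j + 1))\<^sup>2"
          using rec[of j] step.prems ej(2) by (smt (verit) Suc_le_lessD mult_right_mono)
        also have "\<dots> \<le> (1 - 2 / real (j + 1)) * (R / real j) + R / (real (j + 1))\<^sup>2"
          using ej R j' by (intro add_mono mult_left_mono divide_right_mono) (auto simp: field_simps)
        \<comment> \<open>Weakening one factor \<open>j + 1\<close> to \<open>j\<close> makes the
          sum exactly \<open>R / (j + 1)\<close>.\<close>
        also have "\<dots> \<le> (1 - 2 / real (j + 1)) * (R / real j) + R / (real j * real (j + 1))"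
          using R j' by (intro add_mono divide_left_mono) (auto simp: power2_eq_square)
        also have "\<dots> = R / real (Suc j)"
        proof -
          have "(1 - 2 / (y + 1)) * (R / y) + R / (y * (y + 1)) = R / (y + 1)" if "y \<ge> 1" for y :: real
          proof -
            have "1 - 2 / (y + 1) = (y - 1) / (y + 1)" using that by (simp add: field_simps)
            then have "(1 - 2 / (y + 1)) * (R / y) + R / (y * (y + 1))
                = ((y - 1) * R) / (y * (y + 1)) + R / (y * (y + 1))"
              by (simp only: times_divide_times_eq mult.commute[of "y + 1" y])
            also have "\<dots> = (y * R) / (y * (y + 1))"
              by (simp add: left_diff_distrib flip: add_divide_distrib)
            finally show ?thesis using that by simp
          qed
          from this[OF j'] show ?thesis by (simp add: add.commute)
        qed
        finally show ?thesis .
      qed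
    qed
    from this[OF n] show "e n \<le> C * (e 0 + Q) / real n" by (simp add: R_def)
  qed (use C in simp)
qed

text \<open>A discrete Gronwall argument: \<open>d k + 1\<close> grows by at most the factor
  \<open>1 + t k\<close>, which is at most \<open>exp (t k)\<close>.\<close>

lemma bounded_summable_perturbation:
  fixes d t :: "nat \<Rightarrow> real"
  assumes d: "\<And>k. 0 \<le> d k" and t: "\<And>k. 0 \<le> t k" "summable t"
    and rec: "\<And>k. d (Suc k) \<le> d k + t k * (d k + 1)"
  shows "d k \<le> (d 0 + 1) * exp (suminf t)"
proof -
  have "d k + 1 \<le> (d 0 + 1) * exp (sum t {..<k})"
  proof (induction k)
    case (Suc k)
    have "d (Suc k) + 1 \<le> (d k + 1) * (1 + t k)"
      using rec[of k] by (simp add: algebra_simps)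
    also have "\<dots> \<le> ((d 0 + 1) * exp (sum t {..<k})) * exp (t k)"
      using Suc d[of 0] t(1)[of k] by (intro mult_mono) (auto simp: add_increasing)
    finally show ?case by (simp add: exp_add algebra_simps)
  qed simp
  also have "\<dots> \<le> (d 0 + 1) * exp (suminf t)"
    using d[of 0] t by (intro mult_left_mono) (auto intro!: sum_le_suminf)
  finally show ?thesis by simp
qed

lemma summable_shifted_powr:
  assumes "a > 1"
  shows "summable (\<lambda>k. 1 / real (k + 1) powr a)"
proof -
  have "summable (\<lambda>k. real k powr (- a))"
    using assms by (simp add: summable_real_powr_iff)
  then have "summable (\<lambda>k. real (Suc k) powr (- a))"
    by (subst summable_Suc_iff)
  then show ?thesis by (simp add: powr_minus_divide)
qed

text \<open>Dyadic telescoping from time \<open>k\<close> back to about \<open>k / 2\<close>: \<open>W s l\<close> is the residual at time \<open>l\<close>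
  of the error-free trajectory that leaves the perturbed one at time \<open>s\<close>. Passing from the start
  \<open>k + 1 - 2 ^ (i + 2)\<close> to \<open>k + 1 - 2 ^ (i + 1)\<close> costs at most a constant times
  \<open>sqrt (2 ^ i) / k\<close>, and these costs add up to \<open>O(1 / sqrt k)\<close>.\<close>

lemma dyadic_rate:
  fixes W :: "nat \<Rightarrow> nat \<Rightarrow> real" and \<eta> :: "nat \<Rightarrow> real"
  assumes start: "\<And>s. W s s \<le> D"
    and decay: "\<And>s m. m \<ge> 1 \<Longrightarrow> W s (s + m) \<le> D / sqrt (real m)"
    and restart: "\<And>s t m. s \<le> t \<Longrightarrow> m \<ge> 1 \<Longrightarrow> W t (t + m) \<le> W s t + (\<Sum>i=s..<t. \<eta> i) / sqrt (real m)"
    and jump: "\<And>k. W (Suc k) (Suc k) \<le> W k (Suc k) + \<eta> k"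
    and \<eta>: "\<And>k. \<eta> k \<le> c / real (k + 1)" and D: "D \<ge> 0" and c: "c \<ge> 0"
  shows "W k k \<le> (3 * D + 8 * c) / sqrt (real (k + 1))"
proof (cases "k \<ge> 3")
  case False
  then have "sqrt (real (k + 1)) \<le> sqrt 4" by (intro real_sqrt_le_mono) auto
  then have sq: "sqrt (real (k + 1)) \<le> 2" by simp
  have "W k k * sqrt (real (k + 1)) \<le> D * sqrt (real (k + 1))"
    using start by (intro mult_right_mono) auto
  also have "\<dots> \<le> D * 2" using sq D by (intro mult_left_mono) auto
  also have "\<dots> \<le> 3 * D + 8 * c" using D c by simp
  finally show ?thesis by (simp add: field_simps)
next
  case True
  define n where "n = real (k + 1)"
  have n: "n \<ge> 4" using True by (simp add: n_def)
  obtain q where q: "2 ^ q \<le> k + 1" "k + 1 < 2 ^ (q + 1)"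
    using ex_power_ivl1[of 2 "k + 1"] by auto
  have "q \<ge> 2"
  proof (rule ccontr)
    assume "\<not> q \<ge> 2"
    then have "(2::nat) ^ (q + 1) \<le> 2 ^ 2" by (intro power_increasing) auto
    then show False using q(2) True by simp
  qed
  \<comment> \<open>The shift by two ensures that restarts at scales below \<open>p\<close> go back
    at most half of \<open>k + 1\<close>.\<close>
  then obtain p where p: "q = p + 2" by (metis add.commute le_Suc_ex)
  have pn: "4 * (2::nat) ^ p \<le> k + 1" "k + 1 < 8 * 2 ^ p" using q by (auto simp: p)
  \<comment> \<open>Bounds every error committed in the second half of the run.\<close>
  define H where "H = 2 * c / n"
  have H: "H \<ge> 0" using c n by (simp add: H_def)
  \<comment> \<open>The start of the trajectory in \<open>V i\<close> is the time at which
    \<open>V (Suc i)\<close> is evaluated, so \<open>restart\<close> links consecutive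
    scales.\<close>
  define V where "V i = W (k + 1 - 2 ^ (i + 1)) (k + 1 - 2 ^ i)" for i
  have step: "V i \<le> V (Suc i) + 2 * H * sqrt (2 ^ i)" if i: "i < p" for i
  proof -
    have "(2::nat) ^ (i + 2) \<le> 2 ^ (p + 1)" using i by (intro power_increasing) auto
    then have le: "2 * (2::nat) ^ (i + 2) \<le> k + 1" using pn by simp
    define s t where "s = k + 1 - 2 ^ (i + 2)" and "t = k + 1 - 2 ^ (i + 1)"
    have st: "s \<le> t" "t - s = 2 ^ (i + 1)" "t + 2 ^ i = k + 1 - 2 ^ i"
      using le by (auto simp: s_def t_def)
    have "V i \<le> V (Suc i) + (\<Sum>j=s..<t. \<eta> j) / sqrt (real (2 ^ i))"
      using restart[OF st(1), of "2 ^ i"] by (simp add: V_def st(3)) (simp add: s_def t_def)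
    also have "(\<Sum>j=s..<t. \<eta> j) \<le> real (card {s..<t}) * H"
    proof (rule sum_bounded_above)
      fix j assume "j \<in> {s..<t}"
      then have "2 * (j + 1) \<ge> k + 1" using le by (auto simp: s_def)
      then have j: "2 * real (j + 1) \<ge> n" by (simp add: n_def)
      have "\<eta> j \<le> c / real (j + 1)" by (rule \<eta>)
      also have "\<dots> = 2 * c / (2 * real (j + 1))" by (rule mult_divide_mult_cancel_left[symmetric]) simp
      also have "\<dots> \<le> H" unfolding H_def using j c n by (intro divide_left_mono) auto
      finally show "\<eta> j \<le> H" .
    qed
    also have "real (card {s..<t}) * H / sqrt (real (2 ^ i)) = 2 * H * sqrt (2 ^ i)"
    proof -
      define r :: real where "r = sqrt (2 ^ i)"
      have "r > 0" "real (card {s..<t}) = 2 * (r * r)" by (simp_all add: r_def st(2))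
      then show ?thesis by (simp add: r_def[symmetric])
    qed
    finally show ?thesis by (simp add: divide_right_mono)
  qed
  have tele: "V 0 \<le> V i + 6 * H * sqrt (2 ^ i)" if "i \<le> p" for i
    using that
  proof (induction i)
    case (Suc i)
    \<comment> \<open>The constant 6 closes the induction: 6 plus the new cost 2 is at most
      \<open>6 * sqrt 2\<close>, the value at the next scale.\<close>
    have "(8::real) \<le> 6 * sqrt 2" by (rule power2_le_imp_le) (auto simp: power_mult_distrib)
    then have "8 * (H * sqrt (2 ^ i)) \<le> 6 * sqrt 2 * (H * sqrt (2 ^ i))"
      using H by (intro mult_right_mono) auto
    then show ?case using Suc step[of i] by (simp add: real_sqrt_mult algebra_simps)
  qed (use H in simp)
  have rp: "real (2 ^ p) \<le> n / 4" "n / 8 \<le> real (2 ^ p)"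
    using pn unfolding n_def by (simp_all add: field_simps flip: of_nat_power of_nat_mult)
  \<comment> \<open>The coarsest window has length at least \<open>n / 8\<close>; relaxing this to
    \<open>n / 9\<close> gives the rational constant 3.\<close>
  have V_p: "V p \<le> 3 * D / sqrt n"
  proof -
    have "V p \<le> D / sqrt (real (2 ^ p))"
      using decay[of "2 ^ p" "k + 1 - 2 ^ (p + 1)"] pn by (simp add: V_def)
    also have "\<dots> \<le> D / (sqrt n / 3)"
    proof (intro divide_left_mono D)
      have "sqrt (n / 9) \<le> sqrt (real (2 ^ p))" using rp n by (intro real_sqrt_le_mono) auto
      then show "sqrt n / 3 \<le> sqrt (real (2 ^ p))" by (simp add: real_sqrt_divide)
    qed (use n in auto)
    finally show ?thesis by (simp add: mult.commute)
  qed
  have "sqrt (2 ^ p) \<le> sqrt (n / 4)" using rp by (intro real_sqrt_le_mono) auto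
  then have "6 * H * sqrt (2 ^ p) \<le> 6 * H * (sqrt n / 2)"
    using H by (intro mult_left_mono) (auto simp: real_sqrt_divide)
  also have "\<dots> = 6 * c / sqrt n"
  proof -
    have "sqrt n * sqrt n = n" using n by simp
    then show ?thesis using n by (simp add: H_def field_simps)
  qed
  finally have V_0: "V 0 \<le> (3 * D + 6 * c) / sqrt n"
    using tele[of p] V_p by (simp add: add_divide_distrib)
  \<comment> \<open>\<open>V 0\<close> is the exact step from \<open>k - 1\<close> to
    \<open>k\<close>; only the error of that step is missing.\<close>
  have "W k k \<le> V 0 + \<eta> (k - 1)"
    using jump[of "k - 1"] True by (simp add: V_def)
  also have "\<eta> (k - 1) \<le> 2 * c / sqrt n"
  proof -
    have "\<eta> (k - 1) \<le> c / real k" using \<eta>[of "k - 1"] True by simp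
    also have "\<dots> = 2 * c / (2 * real k)" by (rule mult_divide_mult_cancel_left[symmetric]) simp
    also have "\<dots> \<le> 2 * c / sqrt n"
    proof (intro divide_left_mono)
      have "sqrt n \<le> n" using n by (intro real_le_lsqrt) (auto simp: power2_eq_square)
      also have "n \<le> 2 * real k" using True by (simp add: n_def)
      finally show "sqrt n \<le> 2 * real k" .
    qed (use c n True in auto)
    finally show ?thesis .
  qed
  finally show ?thesis using V_0 by (simp add: add_divide_distrib n_def)
qed

section \<open>The inexact proximal point method\<close>

lemma (in finite_measure) sq_integrable_lipschitz_image:
  fixes f :: "'b::euclidean_space \<Rightarrow> 'c::euclidean_space"
  assumes X: "sq_integrable M X" and f: "f \<in> borel_measurable borel"
    and lip: "\<And>x y. norm (f x - f y) \<le> L * norm (x - y)"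
  shows "sq_integrable M (\<lambda>s. f (X s))"
proof -
  have [measurable]: "X \<in> borel_measurable M" by (rule sq_integrable_measurable[OF X])
  note [measurable] = f
  have "sq_integrable M (\<lambda>s. f (X s) - f 0)"
    by (rule sq_integrable_bound[OF X, of _ L]) (use lip[of _ 0] in \<open>auto\<close>)
  from sq_integrable_add[OF this sq_integrable_const[of "f 0"]] show ?thesis by simp
qed

context maximal_monotone_operator
begin

lemma sq_integrable_resolvent:
  assumes "prob_space P" "sq_integrable P X"
  shows "sq_integrable P (\<lambda>s. J (X s))"
proof -
  interpret prob_space P by fact
  show ?thesis
    by (rule sq_integrable_lipschitz_image[OF assms(2), of _ 1]) (use resolvent_nonexpansive in auto)
qed

lemma sq_integrable_yosida:
  assumes "prob_space P" "sq_integrable P X"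
  shows "sq_integrable P (\<lambda>s. Y (X s))"
proof -
  interpret prob_space P by fact
  show ?thesis
    by (rule sq_integrable_lipschitz_image[OF assms(2), of _ "1 / lam"]) (use yosida_lipschitz in auto)
qed

lemma sq_integrable_resolvent_funpow:
  assumes "prob_space P" "sq_integrable P X"
  shows "sq_integrable P (\<lambda>s. (J ^^ n) (X s))"
  by (induction n) (use assms sq_integrable_resolvent in auto)

lemma resolvent_firm_l2norm:
  assumes P: "prob_space P" and A: "sq_integrable P A" and B: "sq_integrable P B"
  shows "(l2norm P (\<lambda>s. J (A s) - J (B s)))\<^sup>2 + lam\<^sup>2 * (l2norm P (\<lambda>s. Y (A s) - Y (B s)))\<^sup>2
    \<le> (l2norm P (\<lambda>s. A s - B s))\<^sup>2"
proof -
  note I = sq_integrable_integrable[OF sq_integrable_diff[OF sq_integrable_resolvent[OF P A] sq_integrable_resolvent[OF P B]]]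
    sq_integrable_integrable[OF sq_integrable_diff[OF sq_integrable_yosida[OF P A] sq_integrable_yosida[OF P B]]]
    sq_integrable_integrable[OF sq_integrable_diff[OF A B]]
  have "(LINT s|P. (norm (J (A s) - J (B s)))\<^sup>2 + lam\<^sup>2 * (norm (Y (A s) - Y (B s)))\<^sup>2)
      \<le> (LINT s|P. (norm (A s - B s))\<^sup>2)"
    by (intro integral_mono resolvent_firm Bochner_Integration.integrable_add integrable_mult_right I)
  then show ?thesis using I by (simp add: l2norm_power2)
qed

text \<open>Firm nonexpansiveness telescopes along two exact trajectories.\<close>

lemma sum_yosida_gap_le:
  assumes P: "prob_space P" and A: "sq_integrable P A" and B: "sq_integrable P B"
  shows "lam\<^sup>2 * (\<Sum>l<m. (l2norm P (\<lambda>s. Y ((J ^^ l) (A s)) - Y ((J ^^ l) (B s))))\<^sup>2)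
    \<le> (l2norm P (\<lambda>s. A s - B s))\<^sup>2"
proof -
  have "(l2norm P (\<lambda>s. (J ^^ m) (A s) - (J ^^ m) (B s)))\<^sup>2
    + lam\<^sup>2 * (\<Sum>l<m. (l2norm P (\<lambda>s. Y ((J ^^ l) (A s)) - Y ((J ^^ l) (B s))))\<^sup>2)
    \<le> (l2norm P (\<lambda>s. A s - B s))\<^sup>2"
  proof (induction m)
    case (Suc m)
    then show ?case
      using resolvent_firm_l2norm[OF P sq_integrable_resolvent_funpow[OF P A, of m] sq_integrable_resolvent_funpow[OF P B, of m]]
      by (simp add: distrib_left)
  qed simp
  then show ?thesis by (smt (verit) zero_le_power2)
qed

text \<open>If all \<open>m\<close> gaps exceeded the bound, their squares would exceed the total
  allowed by \<open>sum_yosida_gap_le\<close>.\<close>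

lemma yosida_gap_le:
  assumes P: "prob_space P" and A: "sq_integrable P A" and B: "sq_integrable P B" and m: "m \<ge> 1"
  shows "\<exists>l<m. l2norm P (\<lambda>s. Y ((J ^^ l) (A s)) - Y ((J ^^ l) (B s)))
    \<le> l2norm P (\<lambda>s. A s - B s) / (lam * sqrt (real m))"
proof (rule ccontr)
  define \<delta> where "\<delta> = l2norm P (\<lambda>s. A s - B s)"
  define g where "g l = l2norm P (\<lambda>s. Y ((J ^^ l) (A s)) - Y ((J ^^ l) (B s)))" for l
  assume "\<not> ?thesis"
  then have g: "\<delta> / (lam * sqrt (real m)) < g l" if "l < m" for l
    using that by (auto simp: \<delta>_def g_def not_le)
  have "\<delta>\<^sup>2 = lam\<^sup>2 * (\<Sum>l<m. (\<delta> / (lam * sqrt (real m)))\<^sup>2)"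
    using m lam by (simp add: power_divide power_mult_distrib)
  also have "\<dots> < lam\<^sup>2 * (\<Sum>l<m. (g l)\<^sup>2)"
    using m lam g by (intro mult_strict_left_mono sum_strict_mono power_strict_mono)
       (auto simp: \<delta>_def lessThan_empty_iff)
  also have "\<dots> \<le> \<delta>\<^sup>2" unfolding \<delta>_def g_def by (rule sum_yosida_gap_le[OF P A B])
  finally show False by simp
qed

lemma l2norm_yosida_funpow_antimono:
  assumes P: "prob_space P" and A: "sq_integrable P A" and "l \<le> m"
  shows "l2norm P (\<lambda>s. Y ((J ^^ m) (A s))) \<le> l2norm P (\<lambda>s. Y ((J ^^ l) (A s)))"
  using \<open>l \<le> m\<close>
proof (induction m rule: dec_induct)
  case (step m)
  have "l2norm P (\<lambda>s. Y ((J ^^ Suc m) (A s))) \<le> l2norm P (\<lambda>s. Y ((J ^^ m) (A s)))"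
    by (intro l2norm_mono sq_integrable_yosida sq_integrable_resolvent_funpow P A)
       (simp add: yosida_resolvent_le)
  then show ?case using step by simp
qed simp

text \<open>\<open>dyadic_rate\<close> is applied to mean-square residuals of exact trajectories
  launched from the random iterates. \<open>yosida_gap_le\<close> supplies both the decay and the
  cost of a restart.\<close>

theorem inexact_proximal_rate:
  assumes P: "prob_space P" and x: "\<And>k. sq_integrable P (x k)" and p: "0 \<in> T p"
    and dist: "\<And>k. l2norm P (\<lambda>s. x k s - p) \<le> d"
    and err: "\<And>k. l2norm P (\<lambda>s. x (Suc k) s - J (x k s)) \<le> c / real (k + 1)"
  shows "l2norm P (\<lambda>s. Y (x k s)) \<le> (3 * d + 8 * c) / lam / sqrt (real (k + 1))"
proof -
  interpret prob_space P by fact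
  define W where "W s l = l2norm P (\<lambda>\<omega>. Y ((J ^^ (l - s)) (x s \<omega>)))" for s l
  define err' where "err' k = l2norm P (\<lambda>s. x (Suc k) s - J (x k s))" for k
  define \<eta> where "\<eta> k = err' k / lam" for k
  note Jx = sq_integrable_resolvent[OF P] and Yx = sq_integrable_yosida[OF P]
    and Jn = sq_integrable_resolvent_funpow[OF P x]
  have Jp: "(J ^^ n) p = p" for n by (induction n) (simp_all add: resolvent_zero[OF p])
  have d: "d \<ge> 0" using order_trans[OF l2norm_nonneg dist[of 0]] .
  have c: "c \<ge> 0" using order_trans[OF l2norm_nonneg err[of 0]] by simp
  have "W k k \<le> (3 * (d / lam) + 8 * (c / lam)) / sqrt (real (k + 1))"
  proof (rule dyadic_rate[where W = W and \<eta> = \<eta>])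
    fix s
    have "l2norm P (\<lambda>\<omega>. Y (x s \<omega>)) \<le> 1 / lam * l2norm P (\<lambda>\<omega>. x s \<omega> - p)"
    proof (rule l2norm_le_scaled)
      show "norm (Y (x s \<omega>)) \<le> 1 / lam * norm (x s \<omega> - p)" for \<omega>
        using yosida_lipschitz[of "x s \<omega>" p] by (simp add: yosida_zero[OF p])
    qed (use lam in \<open>auto intro!: Yx x sq_integrable_diff sq_integrable_const\<close>)
    also have "\<dots> \<le> d / lam" using dist[of s] lam by (simp add: divide_right_mono)
    finally show "W s s \<le> d / lam" by (simp add: W_def)
  next
    fix s m :: nat assume m: "m \<ge> 1"
    \<comment> \<open>Comparison with the constant trajectory at \<open>p\<close>, along which
      \<open>Y\<close> vanishes.\<close>
    obtain l where l: "l < m" "l2norm P (\<lambda>\<omega>. Y ((J ^^ l) (x s \<omega>)) - Y ((J ^^ l) p))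
        \<le> l2norm P (\<lambda>\<omega>. x s \<omega> - p) / (lam * sqrt (real m))"
      using yosida_gap_le[OF P x sq_integrable_const m] by blast
    have "W s (s + m) \<le> l2norm P (\<lambda>\<omega>. Y ((J ^^ l) (x s \<omega>)))"
      using l2norm_yosida_funpow_antimono[OF P x, of l m] l by (simp add: W_def)
    also have "\<dots> \<le> l2norm P (\<lambda>\<omega>. x s \<omega> - p) / (lam * sqrt (real m))"
      using l(2) by (simp add: Jp yosida_zero[OF p])
    also have "\<dots> \<le> d / (lam * sqrt (real m))" using lam by (intro divide_right_mono dist) simp
    finally show "W s (s + m) \<le> d / lam / sqrt (real m)" by simp
  next
    fix s t m :: nat assume st: "s \<le> t" and m: "m \<ge> 1"
    \<comment> \<open>Errors merely add up, because \<open>J\<close> does not amplify earlier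
      ones.\<close>
    have gap: "l2norm P (\<lambda>\<omega>. x t \<omega> - (J ^^ (t - s)) (x s \<omega>)) \<le> (\<Sum>i=s..<t. err' i)"
      using st
    proof (induction t rule: dec_induct)
      case base
      then show ?case by (simp add: l2norm_def)
    next
      case (step t)
      define b where "b \<omega> = (J ^^ (t - s)) (x s \<omega>)" for \<omega>
      have b: "sq_integrable P b" unfolding b_def by (rule Jn)
      have "l2norm P (\<lambda>\<omega>. x (Suc t) \<omega> - J (b \<omega>))
        \<le> err' t + l2norm P (\<lambda>\<omega>. J (x t \<omega>) - J (b \<omega>))"
        unfolding err'_def by (intro l2norm_diff_triangle Jx x b)
      also have "l2norm P (\<lambda>\<omega>. J (x t \<omega>) - J (b \<omega>)) \<le> l2norm P (\<lambda>\<omega>. x t \<omega> - b \<omega>)"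
        by (intro l2norm_mono sq_integrable_diff Jx x b resolvent_nonexpansive)
      finally show ?case using step by (simp add: b_def Suc_diff_le)
    qed
    obtain l where l: "l < m" "l2norm P (\<lambda>\<omega>. Y ((J ^^ l) (x t \<omega>)) - Y ((J ^^ l) ((J ^^ (t - s)) (x s \<omega>))))
        \<le> l2norm P (\<lambda>\<omega>. x t \<omega> - (J ^^ (t - s)) (x s \<omega>)) / (lam * sqrt (real m))"
      using yosida_gap_le[OF P x Jn m] by blast
    have J_add: "(J ^^ l) ((J ^^ (t - s)) y) = (J ^^ (t + l - s)) y" for y
      using st by (simp add: funpow_add[THEN fun_cong, unfolded comp_def, symmetric] algebra_simps)
    \<comment> \<open>The trajectories are switched at the favourable time \<open>t + l\<close>;
      monotone decay bridges \<open>t + l\<close> to \<open>t + m\<close> on one and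
      \<open>t\<close> to \<open>t + l\<close> on the other.\<close>
    have "W t (t + m) \<le> l2norm P (\<lambda>\<omega>. Y ((J ^^ l) (x t \<omega>)))"
      using l2norm_yosida_funpow_antimono[OF P x, of l m] l by (simp add: W_def)
    also have "\<dots> \<le> W s (t + l)
        + l2norm P (\<lambda>\<omega>. Y ((J ^^ l) (x t \<omega>)) - Y ((J ^^ l) ((J ^^ (t - s)) (x s \<omega>))))"
      unfolding W_def J_add by (intro l2norm_le_add_diff Yx Jn)
    also have "W s (t + l) \<le> W s t"
      unfolding W_def by (rule l2norm_yosida_funpow_antimono[OF P x]) simp
    also have "l2norm P (\<lambda>\<omega>. Y ((J ^^ l) (x t \<omega>)) - Y ((J ^^ l) ((J ^^ (t - s)) (x s \<omega>))))
        \<le> (\<Sum>i=s..<t. err' i) / (lam * sqrt (real m))"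
      using l(2) by (rule order_trans) (use gap lam in \<open>auto intro!: divide_right_mono\<close>)
    also have "(\<Sum>i=s..<t. err' i) / (lam * sqrt (real m)) = (\<Sum>i=s..<t. \<eta> i) / sqrt (real m)"
      by (simp add: \<eta>_def sum_divide_distrib)
    finally show "W t (t + m) \<le> W s t + (\<Sum>i=s..<t. \<eta> i) / sqrt (real m)" by simp
  next
    fix k
    have "W (Suc k) (Suc k) \<le> W k (Suc k) + l2norm P (\<lambda>\<omega>. Y (x (Suc k) \<omega>) - Y (J (x k \<omega>)))"
      using l2norm_le_add_diff[OF Yx[OF x] Yx[OF Jx[OF x]], of "Suc k" k] by (simp add: W_def)
    also have "l2norm P (\<lambda>\<omega>. Y (x (Suc k) \<omega>) - Y (J (x k \<omega>)))
        \<le> 1 / lam * l2norm P (\<lambda>\<omega>. x (Suc k) \<omega> - J (x k \<omega>))"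
      by (rule l2norm_le_scaled) (use lam yosida_lipschitz in \<open>auto intro!: Yx Jx x sq_integrable_diff\<close>)
    finally show "W (Suc k) (Suc k) \<le> W k (Suc k) + \<eta> k" by (simp add: \<eta>_def err'_def)
  next
    fix k show "\<eta> k \<le> c / lam / real (k + 1)"
      using divide_right_mono[OF err[of k], of lam] lam
      by (simp add: \<eta>_def err'_def divide_divide_eq_left mult.commute)
  qed (use lam c d in auto)
  then show ?thesis by (simp add: W_def add_divide_distrib)
qed

end

section \<open>Independence from the past\<close>

lemma sq_integrable_cong:
  assumes "\<And>s. s \<in> space M \<Longrightarrow> f s = g s"
  shows "sq_integrable M f \<longleftrightarrow> sq_integrable M g"
  unfolding sq_integrable_def using assms
  by (intro arg_cong2[of _ _ _ _ "(\<and>)"] measurable_cong Bochner_Integration.integrable_cong) auto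

lemma l2norm_cong:
  assumes "\<And>s. s \<in> space M \<Longrightarrow> f s = g s"
  shows "l2norm M f = l2norm M g"
  unfolding l2norm_def using assms by (simp cong: Bochner_Integration.integral_cong)

text \<open>The joint law is a product, so Tonelli applies. Nonnegative integrals avoid
  integrability conditions that are not yet available for the iterates.\<close>

lemma (in prob_space) nn_integral_indep_var:
  assumes ind: "indep_var S X N W" and f: "f \<in> borel_measurable (S \<Otimes>\<^sub>M N)"
  shows "(\<integral>\<^sup>+s. f (X s, W s) \<partial>M) = (\<integral>\<^sup>+s. (\<integral>\<^sup>+w. f (X s, w) \<partial>distr M N W) \<partial>M)"
proof -
  have [measurable]: "X \<in> measurable M S" "W \<in> measurable M N"
    using ind by (auto dest: indep_var_rv1 indep_var_rv2)
  note [measurable] = f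
  interpret W: prob_space "distr M N W" by (rule prob_space_distr) measurable
  have "(\<integral>\<^sup>+s. f (X s, W s) \<partial>M) = (\<integral>\<^sup>+p. f p \<partial>distr M (S \<Otimes>\<^sub>M N) (\<lambda>s. (X s, W s)))"
    by (subst nn_integral_distr) auto
  also have "\<dots> = (\<integral>\<^sup>+p. f p \<partial>(distr M S X \<Otimes>\<^sub>M distr M N W))"
    using ind by (simp add: indep_var_distribution_eq)
  also have "\<dots> = (\<integral>\<^sup>+y. (\<integral>\<^sup>+w. f (y, w) \<partial>distr M N W) \<partial>distr M S X)"
    by (rule W.nn_integral_fst[symmetric]) measurable
  also have "\<dots> = (\<integral>\<^sup>+s. (\<integral>\<^sup>+w. f (X s, w) \<partial>distr M N W) \<partial>M)"
    by (subst nn_integral_distr) auto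
  finally show ?thesis .
qed

text \<open>Measurability with respect to the samples indexed by \<open>A\<close>, given as an
  explicit factorization so that independence of the samples transfers by substitution.\<close>

definition determined_by ::
    "'s measure \<Rightarrow> 'w measure \<Rightarrow> ('i \<Rightarrow> 's \<Rightarrow> 'w) \<Rightarrow> 'i set \<Rightarrow> ('s \<Rightarrow> 'a::topological_space) \<Rightarrow> bool" where
  "determined_by P N W A X \<longleftrightarrow>
     (\<exists>f\<in>borel_measurable (PiM A (\<lambda>_. N)). \<forall>s\<in>space P. X s = f (\<lambda>i\<in>A. W i s))"

lemma determined_by_const: "(\<And>s. s \<in> space P \<Longrightarrow> X s = c) \<Longrightarrow> determined_by P N W A X"
  unfolding determined_by_def by (intro bexI[of _ "\<lambda>_. c"]) auto

lemma determined_by_cong: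
  "determined_by P N W A X \<Longrightarrow> (\<And>s. s \<in> space P \<Longrightarrow> X' s = X s) \<Longrightarrow> determined_by P N W A X'"
  by (auto simp: determined_by_def)

lemma determined_by_mono:
  assumes "determined_by P N W A X" "A \<subseteq> B"
  shows "determined_by P N W B X"
proof -
  obtain f where f: "f \<in> borel_measurable (PiM A (\<lambda>_. N))" "\<And>s. s \<in> space P \<Longrightarrow> X s = f (\<lambda>i\<in>A. W i s)"
    using assms by (auto simp: determined_by_def)
  have "(\<lambda>r. restrict r A) \<in> measurable (PiM B (\<lambda>_. N)) (PiM A (\<lambda>_. N))"
    by (rule measurable_restrict_subset) fact
  from measurable_compose[OF this f(1)]
  have "(\<lambda>r. f (restrict r A)) \<in> borel_measurable (PiM B (\<lambda>_. N))" .
  moreover have "restrict (\<lambda>i\<in>B. W i s) A = (\<lambda>i\<in>A. W i s)" for s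
    using assms(2) by (auto simp: restrict_def fun_eq_iff)
  ultimately show ?thesis
    unfolding determined_by_def by (intro bexI[of _ "\<lambda>r. f (restrict r A)"]) (auto simp: f(2))
qed

lemma determined_by_step:
  assumes X: "determined_by P N W A X" and X': "determined_by P N W A X'" and i: "i \<in> A"
    and h: "h \<in> borel_measurable (borel \<Otimes>\<^sub>M borel \<Otimes>\<^sub>M N)"
    and Z: "\<And>s. s \<in> space P \<Longrightarrow> Z s = h (X s, X' s, W i s)"
  shows "determined_by P N W A Z"
proof -
  obtain f where [measurable]: "f \<in> borel_measurable (PiM A (\<lambda>_. N))" and f: "\<And>s. s \<in> space P \<Longrightarrow> X s = f (\<lambda>i\<in>A. W i s)"
    using X by (auto simp: determined_by_def)
  obtain g where [measurable]: "g \<in> borel_measurable (PiM A (\<lambda>_. N))" and g: "\<And>s. s \<in> space P \<Longrightarrow> X' s = g (\<lambda>i\<in>A. W i s)"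
    using X' by (auto simp: determined_by_def)
  note [measurable] = h measurable_component_singleton[OF i]
  have "(\<lambda>r. h (f r, g r, r i)) \<in> borel_measurable (PiM A (\<lambda>_. N))" by measurable
  then show ?thesis
    unfolding determined_by_def using i by (intro bexI[of _ "\<lambda>r. h (f r, g r, r i)"]) (auto simp: f g Z)
qed

text \<open>Conditioning on the past without conditional expectations: a sample outside
  \<open>A\<close> may be integrated out while \<open>X\<close> and \<open>X'\<close> stay
  frozen.\<close>

lemma (in prob_space) nn_integral_determined_by:
  assumes ind: "indep_vars (\<lambda>_. N) W I" and A: "A \<subseteq> I" "i \<in> I" "i \<notin> A"
    and X: "determined_by M N W A X" and X': "determined_by M N W A X'"
    and h: "h \<in> borel_measurable ((borel \<Otimes>\<^sub>M borel) \<Otimes>\<^sub>M N)"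
  shows "(\<integral>\<^sup>+s. h ((X s, X' s), W i s) \<partial>M) = (\<integral>\<^sup>+s. (\<integral>\<^sup>+w. h ((X s, X' s), w) \<partial>distr M N (W i)) \<partial>M)"
proof -
  obtain f where [measurable]: "f \<in> borel_measurable (PiM A (\<lambda>_. N))" and f: "\<And>s. s \<in> space M \<Longrightarrow> X s = f (\<lambda>i\<in>A. W i s)"
    using X by (auto simp: determined_by_def)
  obtain g where [measurable]: "g \<in> borel_measurable (PiM A (\<lambda>_. N))" and g: "\<And>s. s \<in> space M \<Longrightarrow> X' s = g (\<lambda>i\<in>A. W i s)"
    using X' by (auto simp: determined_by_def)
  note [measurable] = h
  have W [measurable]: "W i \<in> measurable M N"
    using ind A(2) by (auto simp: indep_vars_def)
  define R where "R B s = (\<lambda>i\<in>B. W i s)" for B s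
  \<comment> \<open>Rewrites \<open>h\<close> as a function of two independent blocks of samples,
    the second indexed by \<open>i\<close> alone.\<close>
  define F where "F = (\<lambda>(r, r'). h ((f r, g r), r' i))"
  have ind2: "indep_var (PiM A (\<lambda>_. N)) (R A) (PiM {i} (\<lambda>_. N)) (R {i})"
    unfolding R_def by (rule indep_var_restrict[OF ind]) (use A in auto)
  then have R [measurable]: "R {i} \<in> measurable M (PiM {i} (\<lambda>_. N))" by (rule indep_var_rv2)
  have [measurable]: "(\<lambda>r. r i) \<in> measurable (PiM {i} (\<lambda>_. N)) N"
    by (rule measurable_component_singleton) simp
  have F [measurable]: "F \<in> borel_measurable (PiM A (\<lambda>_. N) \<Otimes>\<^sub>M PiM {i} (\<lambda>_. N))"
    unfolding F_def by measurable
  have "(\<integral>\<^sup>+s. h ((X s, X' s), W i s) \<partial>M) = (\<integral>\<^sup>+s. F (R A s, R {i} s) \<partial>M)"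
    by (intro nn_integral_cong) (simp add: F_def R_def f g)
  also have "\<dots> = (\<integral>\<^sup>+s. (\<integral>\<^sup>+r. F (R A s, r) \<partial>distr M (PiM {i} (\<lambda>_. N)) (R {i})) \<partial>M)"
    by (rule nn_integral_indep_var[OF ind2 F])
  also have "\<dots> = (\<integral>\<^sup>+s. (\<integral>\<^sup>+w. h ((X s, X' s), w) \<partial>distr M N (W i)) \<partial>M)"
  proof (rule nn_integral_cong)
    fix s assume s: "s \<in> space M"
    have RA: "R A s \<in> space (PiM A (\<lambda>_. N))"
      using indep_var_rv1[OF ind2] s by (rule measurable_space)
    have "(\<integral>\<^sup>+r. F (R A s, r) \<partial>distr M (PiM {i} (\<lambda>_. N)) (R {i})) = (\<integral>\<^sup>+t. F (R A s, R {i} t) \<partial>M)"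
      using measurable_compose[OF measurable_Pair1'[OF RA] F] by (intro nn_integral_distr[OF R]) simp
    also have "\<dots> = (\<integral>\<^sup>+t. h ((X s, X' s), W i t) \<partial>M)"
      using s by (simp add: F_def R_def f g)
    also have "\<dots> = (\<integral>\<^sup>+w. h ((X s, X' s), w) \<partial>distr M N (W i))"
      by (subst nn_integral_distr) auto
    finally show "(\<integral>\<^sup>+r. F (R A s, r) \<partial>distr M (PiM {i} (\<lambda>_. N)) (R {i}))
      = (\<integral>\<^sup>+w. h ((X s, X' s), w) \<partial>distr M N (W i))" .
  qed
  finally show ?thesis .
qed

section \<open>Stochastic approximation of the resolvent\<close>

context maximal_monotone_operator
begin

text \<open>The subproblem at \<open>x\<close> is the inclusion \<open>0 \<in> T z + (1 / lam) *\<^sub>R (z - x)\<close>. It is solved by \<open>J x\<close>,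
  and its strong monotonicity with modulus \<open>1 / lam\<close> supplies the term \<open>- 2 * \<alpha> / lam\<close>.\<close>

lemma resolvent_sgd_step:
  fixes V :: "'w \<Rightarrow> 'a" and z x p :: 'a
  assumes Q: "prob_space Q" and V: "integrable Q V" "integrable Q (\<lambda>w. (norm (V w))\<^sup>2)"
    and mean: "(LINT w|Q. V w) \<in> T z"
    and second: "(LINT w|Q. (norm (V w))\<^sup>2) \<le> M1\<^sup>2 * (norm z)\<^sup>2 + M2\<^sup>2"
    and p: "0 \<in> T p" and \<alpha>: "\<alpha> \<ge> 0"
  defines "A \<equiv> 6 * M1\<^sup>2 + 4 / lam\<^sup>2" and "C \<equiv> 6 * M1\<^sup>2 * (norm p)\<^sup>2 + 2 * M2\<^sup>2"
  shows "0 \<le> (1 - 2 * \<alpha> / lam + \<alpha>\<^sup>2 * A) * (norm (z - J x))\<^sup>2 + \<alpha>\<^sup>2 * (A * (norm (x - p))\<^sup>2 + C)"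
    and "(\<integral>\<^sup>+w. ennreal ((norm (z - \<alpha> *\<^sub>R (V w + (1 / lam) *\<^sub>R (z - x)) - J x))\<^sup>2) \<partial>Q)
    \<le> ennreal ((1 - 2 * \<alpha> / lam + \<alpha>\<^sup>2 * A) * (norm (z - J x))\<^sup>2 + \<alpha>\<^sup>2 * (A * (norm (x - p))\<^sup>2 + C))"
proof -
  interpret Q: prob_space Q by fact
  define e where "e = z - J x"
  let ?bound = "(1 - 2 * \<alpha> / lam + \<alpha>\<^sup>2 * A) * (norm (z - J x))\<^sup>2 + \<alpha>\<^sup>2 * (A * (norm (x - p))\<^sup>2 + C)"
  define b where "b = (1 / lam) *\<^sub>R (z - x)"
  define m where "m = (LINT w|Q. V w)"
  \<comment> \<open>The squared new error, expanded so that randomness enters only through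
    \<open>V w\<close> and its squared norm.\<close>
  define h where "h w = (norm (e - \<alpha> *\<^sub>R b))\<^sup>2 - 2 * \<alpha> * ((e - \<alpha> *\<^sub>R b) \<bullet> V w) + \<alpha>\<^sup>2 * (norm (V w))\<^sup>2" for w
  have h: "(norm (z - \<alpha> *\<^sub>R (V w + (1 / lam) *\<^sub>R (z - x)) - J x))\<^sup>2 = h w" for w
  proof -
    have "z - \<alpha> *\<^sub>R (V w + (1 / lam) *\<^sub>R (z - x)) - J x = (e - \<alpha> *\<^sub>R b) - \<alpha> *\<^sub>R V w"
      by (simp add: e_def b_def scaleR_add_right)
    then show ?thesis
      unfolding h_def power2_norm_eq_inner
      by (simp only: inner_diff_left[of "e - \<alpha> *\<^sub>R b"] inner_diff_right[of _ "e - \<alpha> *\<^sub>R b"]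
          inner_scaleR_left[of \<alpha> "V w"] inner_scaleR_right[of _ \<alpha> "V w"] inner_commute[of "V w" "e - \<alpha> *\<^sub>R b"])
         (simp add: power2_eq_square right_diff_distrib)
  qed
  have int: "integrable Q h"
    unfolding h_def using V by (auto intro!: integrable_inner_right)
  have "(LINT w|Q. h w) = (norm (e - \<alpha> *\<^sub>R b))\<^sup>2 - 2 * \<alpha> * ((e - \<alpha> *\<^sub>R b) \<bullet> m) + \<alpha>\<^sup>2 * (LINT w|Q. (norm (V w))\<^sup>2)"
    unfolding h_def m_def using V by (simp add: integrable_inner_right Q.prob_space)
  also have "\<dots> = (norm e)\<^sup>2 - 2 * \<alpha> * (e \<bullet> (m + b))
      + \<alpha>\<^sup>2 * ((norm b)\<^sup>2 + 2 * (b \<bullet> m) + (LINT w|Q. (norm (V w))\<^sup>2))"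
    unfolding power2_norm_eq_inner
    by (simp add: inner_diff_left inner_diff_right inner_add_right inner_commute algebra_simps power2_eq_square)
  also have "\<dots> \<le> (norm e)\<^sup>2 - 2 * \<alpha> * ((norm e)\<^sup>2 / lam)
      + \<alpha>\<^sup>2 * (A * (norm e)\<^sup>2 + (A * (norm (x - p))\<^sup>2 + C))"
  proof (rule add_mono[OF diff_mono[OF order.refl mult_left_mono] mult_left_mono])
    have "0 \<le> (m - Y x) \<bullet> (z - J x)" unfolding m_def by (rule mono[OF mean yosida_mem])
    moreover have "e \<bullet> (m + b) = (m - Y x) \<bullet> (z - J x) + (norm e)\<^sup>2 / lam"
    proof -
      \<comment> \<open>Since \<open>b\<close> equals \<open>e / lam\<close> minus
        \<open>Y x\<close>, the monotone part and the strongly monotone part separate.\<close>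
      have eq: "m + b = (m - Y x) + (1 / lam) *\<^sub>R e"
        by (simp add: b_def e_def yosida_def algebra_simps)
      show ?thesis
        unfolding eq inner_add_right by (simp add: power2_norm_eq_inner inner_commute e_def)
    qed
    ultimately show "(norm e)\<^sup>2 / lam \<le> e \<bullet> (m + b)" by linarith
  next
    have jensen: "(norm m)\<^sup>2 \<le> (LINT w|Q. (norm (V w))\<^sup>2)"
    proof -
      have "0 \<le> (LINT w|Q. (norm (V w))\<^sup>2 - 2 * (m \<bullet> V w) + (norm m)\<^sup>2)"
      proof (rule integral_nonneg_AE, rule AE_I2)
        fix w
        have "(norm (V w))\<^sup>2 - 2 * (m \<bullet> V w) + (norm m)\<^sup>2 = (norm (V w - m))\<^sup>2"
          by (simp add: power2_norm_eq_inner inner_diff_left inner_diff_right inner_commute)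
        then show "0 \<le> (norm (V w))\<^sup>2 - 2 * (m \<bullet> V w) + (norm m)\<^sup>2" by simp
      qed
      also have "\<dots> = (LINT w|Q. (norm (V w))\<^sup>2) - 2 * (m \<bullet> m) + (norm m)\<^sup>2"
        using V by (simp add: integrable_inner_right Q.prob_space m_def[symmetric])
      finally show ?thesis by (simp add: power2_norm_eq_inner)
    qed
    have two: "(norm (y + y'))\<^sup>2 \<le> 2 * (norm y)\<^sup>2 + 2 * (norm y')\<^sup>2" for y y' :: 'a
      using norm_add_power2_le[of 1 1 y y'] by simp
    have "2 * (b \<bullet> m) \<le> (norm b)\<^sup>2 + (norm m)\<^sup>2"
      using zero_le_power2[of "norm (b - m)"]
      by (simp add: power2_norm_eq_inner inner_diff_left inner_diff_right inner_commute)
    then have sum_le: "(norm b)\<^sup>2 + 2 * (b \<bullet> m) + (LINT w|Q. (norm (V w))\<^sup>2)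
        \<le> 2 * (norm b)\<^sup>2 + 2 * (M1\<^sup>2 * (norm z)\<^sup>2 + M2\<^sup>2)"
      using jensen second by simp
    have b_le: "(norm b)\<^sup>2 \<le> 2 / lam\<^sup>2 * (norm e)\<^sup>2 + 2 / lam\<^sup>2 * (norm (x - p))\<^sup>2"
    proof -
      have "lam * norm (Y x) \<le> norm (x - p)"
        using yosida_lipschitz[of x p] lam by (simp add: yosida_zero[OF p] field_simps)
      then have "norm (J x - x) \<le> norm (x - p)"
        using lam by (simp add: yosida_def norm_minus_commute)
      then have "(norm (J x - x))\<^sup>2 \<le> (norm (x - p))\<^sup>2" by (rule power_mono) simp
      moreover have "(norm (z - x))\<^sup>2 \<le> 2 * (norm e)\<^sup>2 + 2 * (norm (J x - x))\<^sup>2"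
        using two[of "z - J x" "J x - x"] by (simp add: e_def)
      ultimately have "(norm (z - x))\<^sup>2 \<le> 2 * (norm e)\<^sup>2 + 2 * (norm (x - p))\<^sup>2" by linarith
      then have "(norm (z - x))\<^sup>2 / lam\<^sup>2 \<le> (2 * (norm e)\<^sup>2 + 2 * (norm (x - p))\<^sup>2) / lam\<^sup>2"
        by (rule divide_right_mono) simp
      then show ?thesis by (simp add: b_def power_divide add_divide_distrib)
    qed
    have z_le: "(norm z)\<^sup>2 \<le> 3 * (norm e)\<^sup>2 + 3 * (norm (x - p))\<^sup>2 + 3 * (norm p)\<^sup>2"
    proof -
      have "norm (J x - p) \<le> norm (x - p)"
        using resolvent_nonexpansive[of x p] by (simp add: resolvent_zero[OF p])
      then have Jp: "(norm (J x - p))\<^sup>2 \<le> (norm (x - p))\<^sup>2" by (rule power_mono) simp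
      \<comment> \<open>The weights 1 and 2 are chosen so that a second splitting with factor 2
        gives the coefficient 3 throughout.\<close>
      have "(norm z)\<^sup>2 \<le> 3 * (norm e)\<^sup>2 + 3 / 2 * (norm ((J x - p) + p))\<^sup>2"
        using norm_add_power2_le[of 1 2 e "J x"] by (simp add: e_def)
      then show ?thesis using Jp two[of "J x - p" p] by linarith
    qed
    have "2 * (norm b)\<^sup>2 + 2 * (M1\<^sup>2 * (norm z)\<^sup>2 + M2\<^sup>2)
        \<le> 2 * (2 / lam\<^sup>2 * (norm e)\<^sup>2 + 2 / lam\<^sup>2 * (norm (x - p))\<^sup>2)
          + 2 * (M1\<^sup>2 * (3 * (norm e)\<^sup>2 + 3 * (norm (x - p))\<^sup>2 + 3 * (norm p)\<^sup>2) + M2\<^sup>2)"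
      using b_le mult_left_mono[OF z_le, of "M1\<^sup>2"] by simp
    also have "\<dots> = A * (norm e)\<^sup>2 + (A * (norm (x - p))\<^sup>2 + C)"
      by (simp add: A_def C_def algebra_simps)
    finally show "(norm b)\<^sup>2 + 2 * (b \<bullet> m) + (LINT w|Q. (norm (V w))\<^sup>2)
        \<le> A * (norm e)\<^sup>2 + (A * (norm (x - p))\<^sup>2 + C)"
      using sum_le by linarith
  qed (use \<alpha> in auto)
  also have "\<dots> = (1 - 2 * \<alpha> / lam + \<alpha>\<^sup>2 * A) * (norm (z - J x))\<^sup>2 + \<alpha>\<^sup>2 * (A * (norm (x - p))\<^sup>2 + C)"
    by (simp add: e_def algebra_simps)
  finally have le: "(LINT w|Q. h w) \<le> ?bound" .
  have "0 \<le> (LINT w|Q. h w)" by (rule integral_nonneg_AE) (simp flip: h)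
  \<comment> \<open>Recorded separately because \<open>ennreal\<close> truncates negative
    values.\<close>
  with le show "0 \<le> ?bound" by linarith
  have "(\<integral>\<^sup>+w. ennreal (h w) \<partial>Q) = ennreal (LINT w|Q. h w)"
    by (rule nn_integral_eq_integral[OF int]) (simp flip: h)
  with le show "(\<integral>\<^sup>+w. ennreal ((norm (z - \<alpha> *\<^sub>R (V w + (1 / lam) *\<^sub>R (z - x)) - J x))\<^sup>2) \<partial>Q) \<le> ennreal ?bound"
    unfolding h by (simp add: ennreal_leI)
qed

text \<open>With the current iterates frozen, \<open>resolvent_sgd_step\<close> applies to the fresh
  sample; \<open>indep\<close> then allows the bound to be integrated over the past.\<close>

lemma resolvent_sgd_step_random:
  fixes v :: "'a \<Rightarrow> 'w \<Rightarrow> 'a" and z z' x :: "'s \<Rightarrow> 'a"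
  assumes P: "prob_space P" and Q: "prob_space Q"
    and v: "(\<lambda>(x, \<omega>). v x \<omega>) \<in> borel_measurable (borel \<Otimes>\<^sub>M Q)"
    and orc: "\<And>y. y \<in> S \<Longrightarrow> integrable Q (v y) \<and> (LINT w|Q. v y w) \<in> T y \<and>
        integrable Q (\<lambda>w. (norm (v y w))\<^sup>2) \<and> (LINT w|Q. (norm (v y w))\<^sup>2) \<le> M1\<^sup>2 * (norm y)\<^sup>2 + M2\<^sup>2"
    and W: "W \<in> measurable P Q"
    and indep: "\<And>h. h \<in> borel_measurable ((borel \<Otimes>\<^sub>M borel) \<Otimes>\<^sub>M Q) \<Longrightarrow>
        (\<integral>\<^sup>+s. h ((z s, x s), W s) \<partial>P) = (\<integral>\<^sup>+s. (\<integral>\<^sup>+w. h ((z s, x s), w) \<partial>Q) \<partial>P)"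
    and z: "sq_integrable P z" and x: "sq_integrable P x" and S: "AE s in P. z s \<in> S"
    and z': "\<And>s. s \<in> space P \<Longrightarrow> z' s = z s - \<alpha> *\<^sub>R (v (z s) (W s) + (1 / lam) *\<^sub>R (z s - x s))"
    and p: "0 \<in> T p" and \<alpha>: "\<alpha> \<ge> 0"
  defines "A \<equiv> 6 * M1\<^sup>2 + 4 / lam\<^sup>2" and "C \<equiv> 6 * M1\<^sup>2 * (norm p)\<^sup>2 + 2 * M2\<^sup>2"
  shows "sq_integrable P z'"
    and "(l2norm P (\<lambda>s. z' s - J (x s)))\<^sup>2
      \<le> (1 - 2 * \<alpha> / lam + \<alpha>\<^sup>2 * A) * (l2norm P (\<lambda>s. z s - J (x s)))\<^sup>2
        + \<alpha>\<^sup>2 * (A * (l2norm P (\<lambda>s. x s - p))\<^sup>2 + C)"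
proof -
  interpret prob_space P by fact
  interpret Q: prob_space Q by fact
  note [measurable] = v W sq_integrable_measurable[OF z] sq_integrable_measurable[OF x]
  define g where "g s = (1 - 2 * \<alpha> / lam + \<alpha>\<^sup>2 * A) * (norm (z s - J (x s)))\<^sup>2
      + \<alpha>\<^sup>2 * (A * (norm (x s - p))\<^sup>2 + C)" for s
  define step where "step = (\<lambda>((y, x), w). y - \<alpha> *\<^sub>R (v y w + (1 / lam) *\<^sub>R (y - x)))"
  have step_meas [measurable]: "step \<in> borel_measurable ((borel \<Otimes>\<^sub>M borel) \<Otimes>\<^sub>M Q)"
  proof -
    have "(\<lambda>q. (\<lambda>(x, \<omega>). v x \<omega>) (fst (fst q), snd q)) \<in> borel_measurable ((borel \<Otimes>\<^sub>M borel) \<Otimes>\<^sub>M Q)"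
      by measurable
    then have [measurable]: "(\<lambda>q. v (fst (fst q)) (snd q)) \<in> borel_measurable ((borel \<Otimes>\<^sub>M borel) \<Otimes>\<^sub>M Q)"
      by simp
    have "(\<lambda>q. fst (fst q) - \<alpha> *\<^sub>R (v (fst (fst q)) (snd q) + (1 / lam) *\<^sub>R (fst (fst q) - snd (fst q))))
        \<in> borel_measurable ((borel \<Otimes>\<^sub>M borel) \<Otimes>\<^sub>M Q)"
      by measurable
    then show ?thesis by (simp add: step_def case_prod_unfold)
  qed
  have Jx: "sq_integrable P (\<lambda>s. J (x s))" by (rule sq_integrable_resolvent[OF P x])
  note I = sq_integrable_integrable[OF sq_integrable_diff[OF z Jx]]
    sq_integrable_integrable[OF sq_integrable_diff[OF x sq_integrable_const]]
  have g: "integrable P g" unfolding g_def using I by auto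
  \<comment> \<open>Built from \<open>step\<close> because \<open>z'\<close> is prescribed only on
    \<open>space P\<close>; this version is visibly measurable.\<close>
  define d where "d s = step ((z s, x s), W s) - J (x s)" for s
  have d_meas [measurable]: "d \<in> borel_measurable P" unfolding d_def by measurable
  have inner: "0 \<le> g s" "(\<integral>\<^sup>+w. ennreal ((norm (step ((z s, x s), w) - J (x s)))\<^sup>2) \<partial>Q) \<le> ennreal (g s)"
    if "z s \<in> S" for s
    using resolvent_sgd_step[of Q "v (z s)" "z s" M1 M2 p \<alpha> "x s"] orc[OF that] Q p \<alpha>
    unfolding step_def g_def A_def C_def prod.case by blast+
  have g_nonneg: "AE s in P. 0 \<le> g s"
    using S by eventually_elim (rule inner)
  have "(\<integral>\<^sup>+s. ennreal ((norm (d s))\<^sup>2) \<partial>P)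
      = (\<integral>\<^sup>+s. (\<integral>\<^sup>+w. ennreal ((norm (step ((z s, x s), w) - J (x s)))\<^sup>2) \<partial>Q) \<partial>P)"
  proof -
    have "(\<lambda>q. ennreal ((norm (step q - J (snd (fst q))))\<^sup>2)) \<in> borel_measurable ((borel \<Otimes>\<^sub>M borel) \<Otimes>\<^sub>M Q)"
      by measurable
    from indep[OF this] show ?thesis by (simp add: d_def)
  qed
  also have "\<dots> \<le> (\<integral>\<^sup>+s. ennreal (g s) \<partial>P)"
    using S inner by (intro nn_integral_mono_AE) auto
  also have "\<dots> = ennreal (LINT s|P. g s)"
    by (rule nn_integral_eq_integral[OF g g_nonneg])
  finally have le: "(\<integral>\<^sup>+s. ennreal ((norm (d s))\<^sup>2) \<partial>P) \<le> ennreal (LINT s|P. g s)" .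
  \<comment> \<open>Finiteness of the nonnegative integral also propagates square
    integrability.\<close>
  have "integrable P (\<lambda>s. (norm (d s))\<^sup>2)"
    using le by (intro integrableI_bounded) (auto intro: le_less_trans)
  then have d: "sq_integrable P d" by (simp add: sq_integrable_def)
  have z'_d: "z' s = d s + J (x s)" if "s \<in> space P" for s
    using z'[OF that] by (simp add: d_def step_def)
  show "sq_integrable P z'"
    using sq_integrable_add[OF d Jx] sq_integrable_cong[of P z' "\<lambda>s. d s + J (x s)"] z'_d by blast
  have "(l2norm P (\<lambda>s. z' s - J (x s)))\<^sup>2 = (l2norm P d)\<^sup>2"
    by (simp add: z'_d cong: l2norm_cong)
  also have "\<dots> = enn2real (\<integral>\<^sup>+s. ennreal ((norm (d s))\<^sup>2) \<partial>P)"
    unfolding l2norm_power2 by (rule integral_eq_nn_integral) auto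
  also have "\<dots> \<le> (LINT s|P. g s)"
    using le g_nonneg by (intro enn2real_leI) (auto intro: integral_nonneg_AE)
  also have "\<dots> = (1 - 2 * \<alpha> / lam + \<alpha>\<^sup>2 * A) * (l2norm P (\<lambda>s. z s - J (x s)))\<^sup>2
        + \<alpha>\<^sup>2 * (A * (l2norm P (\<lambda>s. x s - p))\<^sup>2 + C)"
    unfolding g_def l2norm_power2 using I by (simp add: prob_space)
  finally show "(l2norm P (\<lambda>s. z' s - J (x s)))\<^sup>2 \<le> \<dots>" .
qed

end

section \<open>Error analysis of the nested scheme\<close>

definition past :: "(nat \<Rightarrow> nat) \<Rightarrow> nat \<Rightarrow> nat \<Rightarrow> (nat \<times> nat) set" where
  "past N k j = {(k', j'). j' < N k' \<and> (k' < k \<or> k' = k \<and> j' < j)}"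

text \<open>The past at \<open>(k, j)\<close> excludes the sample \<open>(k, j)\<close> itself,
  which is therefore independent of the iterates it is combined with.\<close>

lemma nested_scheme_determined:
  fixes x :: "nat \<Rightarrow> 's \<Rightarrow> 'a::euclidean_space" and z :: "nat \<Rightarrow> nat \<Rightarrow> 's \<Rightarrow> 'a"
  assumes h: "\<And>j. h j \<in> borel_measurable (borel \<Otimes>\<^sub>M borel \<Otimes>\<^sub>M Q)"
    and x0: "\<And>s. s \<in> space P \<Longrightarrow> x 0 s = c"
    and z0: "\<And>k s. s \<in> space P \<Longrightarrow> z k 0 s = x k s"
    and zS: "\<And>k j s. s \<in> space P \<Longrightarrow> j < N k \<Longrightarrow> z k (Suc j) s = h j (z k j s, x k s, W (k, j) s)"
    and xS: "\<And>k s. s \<in> space P \<Longrightarrow> x (Suc k) s = z k (N k) s"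
  shows "determined_by P Q W (past N k 0) (x k)"
    and "j \<le> N k \<Longrightarrow> determined_by P Q W (past N k j) (z k j)"
proof -
  have inner: "determined_by P Q W (past N k j) (z k j)"
    if x: "determined_by P Q W (past N k 0) (x k)" and "j \<le> N k" for k j
    using \<open>j \<le> N k\<close>
  proof (induction j)
    case 0
    show ?case by (rule determined_by_cong[OF x z0])
  next
    case (Suc j)
    show ?case
    proof (rule determined_by_step[where X = "z k j" and X' = "x k" and i = "(k, j)" and h = "h j"])
      show "determined_by P Q W (past N k (Suc j)) (z k j)"
        by (rule determined_by_mono[of _ _ _ "past N k j"]) (use Suc in \<open>auto simp: past_def\<close>)
      show "determined_by P Q W (past N k (Suc j)) (x k)"
        by (rule determined_by_mono[OF x]) (auto simp: past_def)
      show "z k (Suc j) s = h j (z k j s, x k s, W (k, j) s)" if "s \<in> space P" for s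
        using zS[OF that] Suc.prems by simp
    qed (use Suc.prems h in \<open>auto simp: past_def\<close>)
  qed
  have outer: "determined_by P Q W (past N k 0) (x k)" for k
  proof (induction k)
    case 0
    show ?case by (rule determined_by_const[OF x0])
  next
    case (Suc k)
    \<comment> \<open>The past at \<open>(k, N k)\<close> is contained in the past at
      \<open>(Suc k, 0)\<close>.\<close>
    show ?case
      by (rule determined_by_cong[OF determined_by_mono[OF inner[OF Suc order.refl]] xS])
         (auto simp: past_def)
  qed
  show "determined_by P Q W (past N k 0) (x k)" by (rule outer)
  show "determined_by P Q W (past N k j) (z k j)" if "j \<le> N k" using inner[OF outer that] .
qed

text \<open>The inner rate makes the resolvent error at most
  \<open>\<beta> * (d k + 1) / (k + 1) powr a\<close>, where \<open>d k\<close> is the distance to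
  \<open>p\<close>. Summability first bounds \<open>d k\<close>, and with this bound
  \<open>inexact_proximal_rate\<close> applies.\<close>

theorem (in maximal_monotone_operator) vr_spp_rate:
  fixes v :: "'a \<Rightarrow> 'w \<Rightarrow> 'a" and x :: "nat \<Rightarrow> 's \<Rightarrow> 'a" and z :: "nat \<Rightarrow> nat \<Rightarrow> 's \<Rightarrow> 'a"
    and W :: "nat \<times> nat \<Rightarrow> 's \<Rightarrow> 'w"
  assumes P: "prob_space P" and Q: "prob_space Q"
    and v: "(\<lambda>(x, \<omega>). v x \<omega>) \<in> borel_measurable (borel \<Otimes>\<^sub>M Q)"
    and orc: "\<And>y. y \<in> S \<Longrightarrow> integrable Q (v y) \<and> (LINT w|Q. v y w) \<in> T y \<and>
        integrable Q (\<lambda>w. (norm (v y w))\<^sup>2) \<and> (LINT w|Q. (norm (v y w))\<^sup>2) \<le> M1\<^sup>2 * (norm y)\<^sup>2 + M2\<^sup>2"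
    and ind: "prob_space.indep_vars P (\<lambda>_. Q) W {(k, j). j < N k}"
    and distr: "\<And>k j. j < N k \<Longrightarrow> distr P Q (W (k, j)) = Q"
    and x0: "\<And>s. s \<in> space P \<Longrightarrow> x 0 s = c"
    and z0: "\<And>k s. s \<in> space P \<Longrightarrow> z k 0 s = x k s"
    and zS: "\<And>k j s. s \<in> space P \<Longrightarrow> j < N k \<Longrightarrow> z k (Suc j) s =
        z k j s - (\<theta> / real (j + 1)) *\<^sub>R (v (z k j s) (W (k, j) s) + (1 / lam) *\<^sub>R (z k j s - x k s))"
    and xS: "\<And>k s. s \<in> space P \<Longrightarrow> x (Suc k) s = z k (N k) s"
    and S: "\<And>k j. j < N k \<Longrightarrow> AE s in P. z k j s \<in> S"
    and p: "0 \<in> T p" and \<theta>: "\<theta> > lam" and a: "a > 1"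
    and N: "\<And>k. real (k + 1) powr (2 * a) \<le> real (N k)"
  shows "sq_integrable P (x k)"
    and "\<exists>R. \<forall>k. l2norm P (\<lambda>s. Y (x k s)) \<le> R / sqrt (real (k + 1))"
proof -
  interpret prob_space P by fact
  define A where "A = 6 * M1\<^sup>2 + 4 / lam\<^sup>2"
  define C where "C = 6 * M1\<^sup>2 * (norm p)\<^sup>2 + 2 * M2\<^sup>2"
  have AC: "A \<ge> 0" "C \<ge> 0" by (simp_all add: A_def C_def)
  have \<theta>0: "\<theta> \<ge> 0" using \<theta> lam by simp
  define h where "h j = (\<lambda>(y, x, w). y - (\<theta> / real (j + 1)) *\<^sub>R (v y w + (1 / lam) *\<^sub>R (y - x)))" for j
  have h: "h j \<in> borel_measurable (borel \<Otimes>\<^sub>M borel \<Otimes>\<^sub>M Q)" for j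
  proof -
    note [measurable] = v
    have "(\<lambda>q. (\<lambda>(x, \<omega>). v x \<omega>) (fst q, snd (snd q))) \<in> borel_measurable (borel \<Otimes>\<^sub>M (borel :: 'a measure) \<Otimes>\<^sub>M Q)"
      by measurable
    then have [measurable]: "(\<lambda>q. v (fst q) (snd (snd q))) \<in> borel_measurable (borel \<Otimes>\<^sub>M (borel :: 'a measure) \<Otimes>\<^sub>M Q)"
      by simp
    have "(\<lambda>q. fst q - (\<theta> / real (j + 1)) *\<^sub>R (v (fst q) (snd (snd q)) + (1 / lam) *\<^sub>R (fst q - fst (snd q))))
        \<in> borel_measurable (borel \<Otimes>\<^sub>M borel \<Otimes>\<^sub>M Q)"
      by measurable
    then show ?thesis by (simp add: h_def case_prod_unfold)
  qed
  have zS': "z k (Suc j) s = h j (z k j s, x k s, W (k, j) s)" if "s \<in> space P" "j < N k" for k j s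
    using zS[OF that] by (simp add: h_def)
  note x_det = nested_scheme_determined(1)[OF h x0 z0 zS' xS]
    and z_det = nested_scheme_determined(2)[OF h x0 z0 zS' xS]
  have step: "sq_integrable P (z k (Suc j))"
    "(l2norm P (\<lambda>s. z k (Suc j) s - J (x k s)))\<^sup>2
      \<le> (1 - 2 * (\<theta> / real (j + 1)) / lam + (\<theta> / real (j + 1))\<^sup>2 * A) * (l2norm P (\<lambda>s. z k j s - J (x k s)))\<^sup>2
        + (\<theta> / real (j + 1))\<^sup>2 * (A * (l2norm P (\<lambda>s. x k s - p))\<^sup>2 + C)"
    if x: "sq_integrable P (x k)" and z: "sq_integrable P (z k j)" and j: "j < N k" for k j
  proof -
    have W: "W (k, j) \<in> measurable P Q" using ind j by (auto simp: indep_vars_def)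
    have indep: "(\<integral>\<^sup>+s. h ((z k j s, x k s), W (k, j) s) \<partial>P) = (\<integral>\<^sup>+s. (\<integral>\<^sup>+w. h ((z k j s, x k s), w) \<partial>Q) \<partial>P)"
      if "h \<in> borel_measurable ((borel \<Otimes>\<^sub>M borel) \<Otimes>\<^sub>M Q)" for h :: "('a \<times> 'a) \<times> 'w \<Rightarrow> ennreal"
    proof -
      have "determined_by P Q W (past N k j) (x k)"
        by (rule determined_by_mono[OF x_det]) (auto simp: past_def)
      then have "(\<integral>\<^sup>+s. h ((z k j s, x k s), W (k, j) s) \<partial>P)
          = (\<integral>\<^sup>+s. (\<integral>\<^sup>+w. h ((z k j s, x k s), w) \<partial>distr P Q (W (k, j))) \<partial>P)"
        using j that by (intro nn_integral_determined_by[OF ind _ _ _ z_det]) (auto simp: past_def)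
      then show ?thesis by (simp add: distr[OF j])
    qed
    note sgd = resolvent_sgd_step_random[OF P Q v orc W indep z x S[OF j] zS[OF _ j] p]
    have \<alpha>: "0 \<le> \<theta> / real (j + 1)" using \<theta>0 by simp
    show "sq_integrable P (z k (Suc j))" by (rule sgd(1)) (use \<alpha> in auto)
    show "(l2norm P (\<lambda>s. z k (Suc j) s - J (x k s)))\<^sup>2
      \<le> (1 - 2 * (\<theta> / real (j + 1)) / lam + (\<theta> / real (j + 1))\<^sup>2 * A) * (l2norm P (\<lambda>s. z k j s - J (x k s)))\<^sup>2
        + (\<theta> / real (j + 1))\<^sup>2 * (A * (l2norm P (\<lambda>s. x k s - p))\<^sup>2 + C)"
      unfolding A_def C_def by (rule sgd(2)) (use \<alpha> in auto)
  qed
  have z_sq: "sq_integrable P (z k j)" if x: "sq_integrable P (x k)" and "j \<le> N k" for k j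
    using \<open>j \<le> N k\<close>
  proof (induction j)
    case 0
    show ?case using x z0[of _ k] sq_integrable_cong[of P "z k 0" "x k"] by blast
  next
    case (Suc j)
    then show ?case using step(1)[OF x] by simp
  qed
  have x_sq: "sq_integrable P (x k)" for k
  proof (induction k)
    case 0
    show ?case using x0 sq_integrable_const[of c] sq_integrable_cong[of P "x 0" "\<lambda>_. c"] by blast
  next
    case (Suc k)
    show ?case using z_sq[OF Suc order.refl] xS[of _ k] sq_integrable_cong[of P "x (Suc k)" "z k (N k)"] by blast
  qed
  show "sq_integrable P (x k)" by (rule x_sq)
  note Jx = sq_integrable_resolvent[OF P x_sq]
  define d where "d k = l2norm P (\<lambda>s. x k s - p)" for k
  have d0: "d k \<ge> 0" for k by (simp add: d_def)
  define err where "err k = l2norm P (\<lambda>s. x (Suc k) s - J (x k s))" for k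
  \<comment> \<open>The condition \<open>c > 2\<close> of \<open>robbins_monro_rate\<close> is
    exactly \<open>\<theta> > lam\<close>.\<close>
  have "2 < 2 * \<theta> / lam" using \<theta> lam by (simp add: pos_less_divide_eq)
  moreover have "0 \<le> \<theta>\<^sup>2 * A" using AC by simp
  ultimately obtain B where B: "B \<ge> 0" and rate: "\<And>(e::nat \<Rightarrow> real) q n. \<lbrakk>0 \<le> q; n \<ge> 1; \<And>j. j \<le> n \<Longrightarrow> 0 \<le> e j;
       \<And>j. j < n \<Longrightarrow> e (Suc j) \<le> (1 - 2 * \<theta> / lam / real (j + 1) + \<theta>\<^sup>2 * A / (real (j + 1))\<^sup>2) * e j + q / (real (j + 1))\<^sup>2\<rbrakk>
      \<Longrightarrow> e n \<le> B * (e 0 + q) / real n"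
    using robbins_monro_rate[of "2 * \<theta> / lam" "\<theta>\<^sup>2 * A"] by blast
  \<comment> \<open>The three summands cover the initial error, the growth with the distance to
    \<open>p\<close> and the constant noise.\<close>
  define \<beta> where "\<beta> = sqrt (B * (1 + \<theta>\<^sup>2 * A + \<theta>\<^sup>2 * C))"
  have \<beta>: "\<beta> \<ge> 0" "\<beta>\<^sup>2 = B * (1 + \<theta>\<^sup>2 * A + \<theta>\<^sup>2 * C)" using B AC by (simp_all add: \<beta>_def)
  have err: "err k \<le> \<beta> * (d k + 1) / real (k + 1) powr a" for k
  proof -
    define e where "e j = (l2norm P (\<lambda>s. z k j s - J (x k s)))\<^sup>2" for j
    define q where "q = \<theta>\<^sup>2 * (A * (d k)\<^sup>2 + C)"
    have Npos: "0 < real (k + 1) powr (2 * a)" by simp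
    then have N1: "N k \<ge> 1" using N[of k] by linarith
    have q: "q \<ge> 0" using AC by (simp add: q_def)
    have "e (N k) \<le> B * (e 0 + q) / real (N k)"
    proof (rule rate[OF q N1])
      show "e (Suc j) \<le> (1 - 2 * \<theta> / lam / real (j + 1) + \<theta>\<^sup>2 * A / (real (j + 1))\<^sup>2) * e j + q / (real (j + 1))\<^sup>2"
        if "j < N k" for j
        using step(2)[OF x_sq z_sq[OF x_sq] that] that
        by (simp add: e_def q_def d_def power_divide mult.commute divide_divide_eq_left)
    qed (simp add: e_def)
    also have "\<dots> \<le> B * (e 0 + q) / real (k + 1) powr (2 * a)"
      using N[of k] Npos B q N1 by (intro divide_left_mono mult_nonneg_nonneg mult_pos_pos) (auto simp: e_def)
    \<comment> \<open>The inner loop starts at \<open>x k\<close>, so its initial error is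
      \<open>lam *\<^sub>R Y (x k s)\<close>.\<close>
    also have "e 0 \<le> (d k)\<^sup>2"
    proof -
      have "l2norm P (\<lambda>s. z k 0 s - J (x k s)) = l2norm P (\<lambda>s. lam *\<^sub>R Y (x k s))"
        using lam by (intro l2norm_cong) (simp add: z0 yosida_def)
      also have "\<dots> \<le> d k"
      proof -
        have "norm (lam *\<^sub>R Y y) \<le> norm (y - p)" for y
          using yosida_lipschitz[of y p] lam by (simp add: yosida_zero[OF p] field_simps)
        moreover have "sq_integrable P (\<lambda>s. lam *\<^sub>R Y (x k s))"
          using sq_integrable_diff[OF x_sq[of k] Jx[of k]] lam by (simp add: yosida_def)
        ultimately show ?thesis
          unfolding d_def by (intro l2norm_mono sq_integrable_diff x_sq sq_integrable_const)
      qed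
      finally show ?thesis unfolding e_def by (intro power_mono) auto
    qed
    also have "B * ((d k)\<^sup>2 + q) \<le> \<beta>\<^sup>2 * (d k + 1)\<^sup>2"
    proof -
      have d1: "(d k)\<^sup>2 \<le> (d k + 1)\<^sup>2" "1 \<le> (d k + 1)\<^sup>2"
        using d0[of k] by (auto intro!: power_mono one_le_power)
      have "(d k)\<^sup>2 + q = (d k)\<^sup>2 + \<theta>\<^sup>2 * A * (d k)\<^sup>2 + \<theta>\<^sup>2 * C * 1" by (simp add: q_def algebra_simps)
      also have "\<dots> \<le> (d k + 1)\<^sup>2 + \<theta>\<^sup>2 * A * (d k + 1)\<^sup>2 + \<theta>\<^sup>2 * C * (d k + 1)\<^sup>2"
        using d1 AC by (intro add_mono mult_left_mono) auto
      finally have "B * ((d k)\<^sup>2 + q) \<le> B * ((d k + 1)\<^sup>2 + \<theta>\<^sup>2 * A * (d k + 1)\<^sup>2 + \<theta>\<^sup>2 * C * (d k + 1)\<^sup>2)"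
        using B by (rule mult_left_mono)
      then show ?thesis by (simp add: \<beta>(2) algebra_simps)
    qed
    finally have "e (N k) \<le> \<beta>\<^sup>2 * (d k + 1)\<^sup>2 / real (k + 1) powr (2 * a)"
      using B by (simp add: divide_right_mono mult_left_mono)
    also have "\<dots> = (\<beta> * (d k + 1) / real (k + 1) powr a)\<^sup>2"
      by (simp add: power_divide power_mult_distrib powr_power mult.commute)
    also have "e (N k) = (err k)\<^sup>2"
      unfolding e_def err_def by (simp add: xS cong: l2norm_cong)
    finally show ?thesis
      by (rule power2_le_imp_le) (use \<beta>(1) d0[of k] in simp)
  qed
  \<comment> \<open>Summable since \<open>a > 1\<close>.\<close>
  define t where "t k = \<beta> / real (k + 1) powr a" for k
  define D where "D = (d 0 + 1) * exp (suminf t)"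
  have D: "d k \<le> D" for k
    unfolding D_def
  proof (rule bounded_summable_perturbation[OF d0])
    show "0 \<le> t k" for k using \<beta>(1) by (simp add: t_def)
    show "summable t"
      using summable_mult[OF summable_shifted_powr[OF a], of \<beta>] by (simp add: t_def[abs_def])
    fix k
    have "d (Suc k) \<le> err k + l2norm P (\<lambda>s. J (x k s) - p)"
      unfolding d_def err_def by (intro l2norm_diff_triangle x_sq Jx sq_integrable_const)
    also have "l2norm P (\<lambda>s. J (x k s) - p) \<le> d k"
      unfolding d_def
      by (intro l2norm_mono sq_integrable_diff x_sq Jx sq_integrable_const)
         (use resolvent_nonexpansive[of _ p] in \<open>simp add: resolvent_zero[OF p]\<close>)
    finally show "d (Suc k) \<le> d k + t k * (d k + 1)" using err[of k] by (simp add: t_def)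
  qed
  have "l2norm P (\<lambda>s. Y (x k s)) \<le> (3 * D + 8 * (\<beta> * (D + 1))) / lam / sqrt (real (k + 1))" for k
  proof (rule inexact_proximal_rate[OF P x_sq p])
    show "l2norm P (\<lambda>s. x k s - p) \<le> D" for k using D[of k] by (simp add: d_def)
    fix k
    have "err k \<le> \<beta> * (d k + 1) / real (k + 1) powr a" by (rule err)
    also have "\<dots> \<le> \<beta> * (D + 1) / real (k + 1)"
    proof (intro frac_le mult_left_mono add_right_mono D)
      \<comment> \<open>Once the iterates are bounded, errors of order \<open>1 / (k + 1)\<close>
        suffice.\<close>
      have "real (k + 1) powr 1 \<le> real (k + 1) powr a" using a by (intro powr_mono) auto
      then show "real (k + 1) \<le> real (k + 1) powr a" by simp
    qed (use \<beta>(1) d0[of k] D[of k] in auto)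
    finally show "l2norm P (\<lambda>s. x (Suc k) s - J (x k s)) \<le> \<beta> * (D + 1) / real (k + 1)"
      by (simp add: err_def)
  qed
  then show "\<exists>R. \<forall>k. l2norm P (\<lambda>s. Y (x k s)) \<le> R / sqrt (real (k + 1))" by blast
qed

section \<open>Rate and oracle complexity\<close>

text \<open>The stopping index \<open>L\<close> is \<open>O(1 / \<epsilon>)\<close>, and each of the
  \<open>L + 1\<close> summands is at most twice \<open>(L + 1) powr (2 * a)\<close>.\<close>

lemma oracle_complexity_bigo:
  fixes y :: "nat \<Rightarrow> real" and a C :: real and N :: "nat \<Rightarrow> nat"
  assumes y: "\<And>k. y k \<le> C / real (k + 1)" and a: "a > 0"
    and N: "\<And>k. N k = nat \<lceil>real (k + 1) powr (2 * a)\<rceil>"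
  shows "(\<lambda>\<epsilon>. real (\<Sum>k\<le>(LEAST K. y (K + 1) \<le> \<epsilon>). N k)) \<in> O[at_right 0](\<lambda>\<epsilon>. 1 / \<epsilon> powr (2 * a + 1))"
proof (rule bigoI)
  define B where "B = \<bar>C\<bar>"
  have B: "B \<ge> 0" "y k \<le> B / real (k + 1)" for k
    using order_trans[OF y divide_right_mono[of C B "real (k + 1)"]] by (auto simp: B_def)
  have "eventually (\<lambda>\<epsilon>::real. 0 < \<epsilon> \<and> \<epsilon> < 1) (at_right 0)"
    by (auto simp: eventually_at_right[of 0 1] intro!: exI[of _ 1])
  then show "eventually (\<lambda>\<epsilon>. norm (real (\<Sum>k\<le>(LEAST K. y (K + 1) \<le> \<epsilon>). N k))
      \<le> 2 * (B + 2) powr (2 * a + 1) * norm (1 / \<epsilon> powr (2 * a + 1))) (at_right 0)"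
  proof eventually_elim
    case (elim \<epsilon>)
    define L where "L = (LEAST K. y (K + 1) \<le> \<epsilon>)"
    define l where "l = real (L + 1)"
    \<comment> \<open>An explicit admissible index, which bounds the least one.\<close>
    have "y (nat \<lceil>B / \<epsilon>\<rceil> + 1) \<le> \<epsilon>"
    proof -
      have "B / \<epsilon> \<le> real (nat \<lceil>B / \<epsilon>\<rceil> + 1 + 1)" by linarith
      then have "B \<le> \<epsilon> * real (nat \<lceil>B / \<epsilon>\<rceil> + 1 + 1)"
        using elim by (simp add: pos_divide_le_eq mult.commute)
      then have "B / real (nat \<lceil>B / \<epsilon>\<rceil> + 1 + 1) \<le> \<epsilon>"
        by (simp add: pos_divide_le_eq)
      then show ?thesis using B(2)[of "nat \<lceil>B / \<epsilon>\<rceil> + 1"] by linarith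
    qed
    then have "L \<le> nat \<lceil>B / \<epsilon>\<rceil>" unfolding L_def by (rule Least_le)
    moreover have "B / \<epsilon> \<ge> 0" using B(1) elim by simp
    ultimately have "l \<le> B / \<epsilon> + 2" unfolding l_def by linarith
    \<comment> \<open>Rounding and index shifts are absorbed using
      \<open>\<epsilon> < 1\<close>.\<close>
    also have "\<dots> \<le> B / \<epsilon> + 2 / \<epsilon>" using elim by (simp add: field_simps)
    finally have l: "l \<le> (B + 2) / \<epsilon>" "l \<ge> 1" by (simp_all add: add_divide_distrib l_def)
    have N_le: "real (N k) \<le> 2 * l powr (2 * a)" if "k \<le> L" for k
    proof -
      have "real (k + 1) powr (2 * a) \<le> l powr (2 * a)"
        using that a by (intro powr_mono2) (auto simp: l_def)
      moreover have "1 \<le> l powr (2 * a)" using l a by (intro ge_one_powr_ge_zero) auto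
      moreover have "real (N k) \<le> real (k + 1) powr (2 * a) + 1"
        unfolding N using powr_ge_zero[of "real (k + 1)" "2 * a"] by linarith
      ultimately show ?thesis by linarith
    qed
    have "real (\<Sum>k\<le>L. N k) \<le> (\<Sum>k\<le>L. 2 * l powr (2 * a))"
      unfolding of_nat_sum by (intro sum_mono N_le) auto
    also have "\<dots> = 2 * l powr (2 * a + 1)"
      using l by (simp add: powr_add l_def)
    also have "\<dots> \<le> 2 * ((B + 2) / \<epsilon>) powr (2 * a + 1)"
      using l a by (intro mult_left_mono powr_mono2) auto
    also have "\<dots> = 2 * (B + 2) powr (2 * a + 1) * (1 / \<epsilon> powr (2 * a + 1))"
      using elim B(1) by (simp add: powr_divide)
    finally show ?case by (simp add: L_def abs_of_nonneg sum_nonneg)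
  qed
qed

text \<open>The integrability claim rules out the default value 0 of the integral, and the existence
  of an admissible \<open>K\<close> gives \<open>LEAST\<close> its intended meaning.\<close>

theorem proposition7:
  fixes G :: "('n::finite, 'i::finite, 'y::euclidean_space, 'w) hgame"
    and v :: "real ^ 'n \<Rightarrow> 'w \<Rightarrow> real ^ 'n"
    and P :: "'s measure"
    and \<omega> :: "nat \<Rightarrow> nat \<Rightarrow> 's \<Rightarrow> 'w"
    and x0 :: "real ^ 'n"
    and x :: "nat \<Rightarrow> 's \<Rightarrow> real ^ 'n"
    and z :: "nat \<Rightarrow> nat \<Rightarrow> 's \<Rightarrow> real ^ 'n"
    and N :: "nat \<Rightarrow> nat"
    and lam \<theta> a M1 M2 :: real
  assumes game: "hierarchical_game G"
    and nash: "\<exists>xs. nash_equilibrium G xs"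
    and zero: "\<exists>xs. 0 \<in> game_op G xs"
    and maxmono: "maximal_monotone (game_op G)"
    and orc: "first_order_oracle G v M1 M2"
    and lam: "lam > 0" and \<theta>: "\<theta> > lam" and a: "a > 1"
    and N: "\<And>k. N k = nat \<lceil>real (k + 1) powr (2 * a)\<rceil>"
    and P: "prob_space P"
    and samples: "fresh_samples P (smp G) N \<omega>"
    and scheme: "vr_spp G v P \<omega> lam \<theta> N x0 x z"
  shows "(\<forall>k. integrable P (\<lambda>s. (norm (yosida lam (game_op G) (x k s)))\<^sup>2)) \<and>
         (\<exists>C. \<forall>k. (LINT s|P. (norm (yosida lam (game_op G) (x k s)))\<^sup>2) \<le> C / real (k + 1)) \<and>
         (\<forall>\<epsilon>>0. \<exists>K. (LINT s|P. (norm (yosida lam (game_op G) (x (K + 1) s)))\<^sup>2) \<le> \<epsilon>) \<and>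
         (\<lambda>\<epsilon>. real (\<Sum>k\<le>(LEAST K. (LINT s|P. (norm (yosida lam (game_op G) (x (K + 1) s)))\<^sup>2) \<le> \<epsilon>). N k))
           \<in> O[at_right 0](\<lambda>\<epsilon>. 1 / \<epsilon> powr (2 * a + 1))"
proof -
  interpret maximal_monotone_operator "game_op G" lam
    by unfold_locales (fact maxmono lam)+
  obtain p where p: "0 \<in> game_op G p" using zero by blast
  define W where "W = (\<lambda>(k, j). \<omega> k j)"
  have Q: "prob_space (smp G)" using game by (simp add: hierarchical_game_def)
  have v: "(\<lambda>(x, \<omega>). v x \<omega>) \<in> borel_measurable (borel \<Otimes>\<^sub>M smp G)"
    and v_orc: "\<And>y. y \<in> profiles G \<Longrightarrow> integrable (smp G) (v y) \<and> (LINT w|smp G. v y w) \<in> game_op G y \<and>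
        integrable (smp G) (\<lambda>w. (norm (v y w))\<^sup>2) \<and>
        (LINT w|smp G. (norm (v y w))\<^sup>2) \<le> M1\<^sup>2 * (norm y)\<^sup>2 + M2\<^sup>2"
    using orc by (auto simp: first_order_oracle_def)
  have ind: "prob_space.indep_vars P (\<lambda>_. smp G) W {(k, j). j < N k}"
    and distr: "\<And>k j. j < N k \<Longrightarrow> distr P (smp G) (W (k, j)) = smp G"
    using samples by (auto simp: fresh_samples_def W_def)
  have run: "\<And>s. s \<in> space P \<Longrightarrow> x 0 s = x0"
    "\<And>k s. s \<in> space P \<Longrightarrow> z k 0 s = x k s"
    "\<And>k j s. s \<in> space P \<Longrightarrow> j < N k \<Longrightarrow> z k (Suc j) s =
        z k j s - (\<theta> / real (j + 1)) *\<^sub>R (v (z k j s) (W (k, j) s) + (1 / lam) *\<^sub>R (z k j s - x k s))"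
    "\<And>k s. s \<in> space P \<Longrightarrow> x (Suc k) s = z k (N k) s"
    "\<And>k j. j < N k \<Longrightarrow> AE s in P. z k j s \<in> profiles G"
    using scheme by (simp_all add: vr_spp_def W_def)
  have N_ge: "real (k + 1) powr (2 * a) \<le> real (N k)" for k
    unfolding N by linarith
  note rate = vr_spp_rate[OF P Q v v_orc ind distr run p \<theta> a N_ge]
  have sq: "sq_integrable P (\<lambda>s. Y (x k s))" for k
    by (rule sq_integrable_yosida[OF P rate(1)])
  obtain R where R: "\<And>k. l2norm P (\<lambda>s. Y (x k s)) \<le> R / sqrt (real (k + 1))"
    using rate(2) by blast
  define y where "y k = (LINT s|P. (norm (Y (x k s)))\<^sup>2)" for k
  have y: "y k \<le> R\<^sup>2 / real (k + 1)" for k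
  proof -
    have "y k \<le> (R / sqrt (real (k + 1)))\<^sup>2"
      unfolding y_def l2norm_power2[symmetric] by (rule power_mono[OF R]) simp
    then show ?thesis by (simp add: power_divide)
  qed
  have "\<exists>K. y (K + 1) \<le> \<epsilon>" if "\<epsilon> > 0" for \<epsilon>
  proof -
    obtain K :: nat where "R\<^sup>2 / \<epsilon> \<le> real K" using real_arch_simple by blast
    then have "R\<^sup>2 / \<epsilon> \<le> real (K + 1 + 1)" by simp
    then have "R\<^sup>2 / real (K + 1 + 1) \<le> \<epsilon>"
      using that by (simp add: pos_divide_le_eq mult.commute)
    then show ?thesis using y[of "K + 1"] by (intro exI[of _ K]) linarith
  qed
  moreover have "(\<lambda>\<epsilon>. real (\<Sum>k\<le>(LEAST K. y (K + 1) \<le> \<epsilon>). N k)) \<in> O[at_right 0](\<lambda>\<epsilon>. 1 / \<epsilon> powr (2 * a + 1))"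
    using a by (intro oracle_complexity_bigo[OF y _ N]) simp
  ultimately show ?thesis
    using sq_integrable_integrable[OF sq] y unfolding y_def by blast
qed

end
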